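(* Consider the uniform-agent case $A(\theta_i)\equiv A$, and assume A3) and A4) (as stated in the context). If no eigenvalue of the matrix $$M=\begin{bmatrix}\bar A-\frac{\rho}{2}I & B(R+D^TPD)^{-1}B^T\\ -Q & -\bar A^T+\frac{\rho}{2}I\end{bmatrix}$$ lies on the imaginary axis (i.e. the real part of every eigenvalue of $M$ is nonzero), then the system $$\rho s(t)=\frac{ds}{dt}+\bar A^Ts(t)-Q\bar x(t),\qquad \frac{d\bar x}{dt}=\bar A\bar x(t)-B(R+D^TPD)^{-1}B^Ts(t),$$ with $\bar x(0)=\bar x_0$ given and $s(0)$ not prescribed (to be determined), has a unique solution $(s,\bar x)\in C_{\rho/2}([0,\infty),\mathbb{R}^{2n})$.
   Context: $\rho\ge 0$; $A,C\in\mathbb{R}^{n\times n}$, $B,D\in\mathbb{R}^{n\times r}$ are constant matrices; $Q\in\mathbb{R}^{n\times n}$, $R\in\mathbb{R}^{r\times r}$ are symmetric; $\bar x_0\in\mathbb{R}^n$ is given. $W$ and $W_i$ denote one-dimensional standard Brownian motions. $C_{\rho/2}([0,\infty),\mathbb{R}^m)$ is the set of continuous $f:[0,\infty)\to\mathbb{R}^m$ with $\int_0^\infty e^{-\rho t}\|f(t)\|^2dt<\infty$. A3) ($\rho$-stabilizability, uniform case) There is a feedback gain $K$ such that for every initial state in $\mathbb{R}^n$ the solution of $dx=(A+BK)x\,dt+(C+DK)x\,dW$ satisfies $\mathbb{E}\int_0^\infty e^{-\rho t}\|x(t)\|^2dt<\infty$. A4) (uniform case) $R>0$, $Q\ge 0$,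 and $[A-\frac{\rho}{2}I,C,\sqrt Q]$ is exactly detectable: for the system $dz=(A-\frac{\rho}{2}I)z\,dt+Cz\,dW$, $y=\sqrt Q z$, if $y(t)=0$ a.s. for $t\in[0,T]$ for all $T>0$, then $\lim_{t\to\infty}\mathbb{E}\|z(t)\|^2=0$. $P$ is the (unique) positive semidefinite solution of $$\rho P=A^TP+PA+C^TPC+Q-(B^TP+D^TPC)^T(R+D^TPD)^{-1}(B^TP+D^TPC),$$ and $\bar A=A-B(R+D^TPD)^{-1}(B^TP+D^TPC)$. *)

theory Defs
  imports "HOL-Probability.Probability"
begin

section \<open>Matrices\<close>

definition pos_semidef :: "real^'n^'n \<Rightarrow> bool" where
  "pos_semidef S \<longleftrightarrow> transpose S = S \<and> (\<forall>x. 0 \<le> x \<bullet> (S *v x))"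

definition pos_def :: "real^'n^'n \<Rightarrow> bool" where
  "pos_def S \<longleftrightarrow> transpose S = S \<and> (\<forall>x. x \<noteq> 0 \<longrightarrow> 0 < x \<bullet> (S *v x))"

text \<open>Only meaningful for positive semidefinite arguments, where the positive semidefinite
  root exists and is unique.\<close>

definition matrix_sqrt :: "real^'n^'n \<Rightarrow> real^'n^'n" where
  "matrix_sqrt Q = (THE S. pos_semidef S \<and> S ** S = Q)"

definition block_matrix ::
  "'a^'n^'n \<Rightarrow> 'a^'m^'n \<Rightarrow> 'a^'n^'m \<Rightarrow> 'a^'m^'m \<Rightarrow> 'a^('n + 'm)^('n + 'm)" where
  "block_matrix M11 M12 M21 M22 = (\<chi> i j. case i of
      Inl a \<Rightarrow> (case j of Inl b \<Rightarrow> M11 $ a $ b | Inr b \<Rightarrow> M12 $ a $ b)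
    | Inr a \<Rightarrow> (case j of Inl b \<Rightarrow> M21 $ a $ b | Inr b \<Rightarrow> M22 $ a $ b))"

definition complex_eigenvalue :: "real^'n^'n \<Rightarrow> complex \<Rightarrow> bool" where
  "complex_eigenvalue S l \<longleftrightarrow> (\<exists>v. v \<noteq> 0 \<and> map_matrix complex_of_real S *v v = l *s v)"

section \<open>Brownian motion and linear stochastic differential equations\<close>

text \<open>Completeness and right-continuity of the filtration are not required, so filtrations
  satisfying the usual conditions are a special case.\<close>

locale brownian_motion = prob_space \<Omega>
  for \<Omega> :: "'w measure" +
  fixes F :: "real \<Rightarrow> 'w measure" and W :: "real \<Rightarrow> 'w \<Rightarrow> real"
  assumes subalgebra_F: "\<And>t. 0 \<le> t \<Longrightarrow> subalgebra \<Omega> (F t)"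
    and mono_F: "\<And>s t. 0 \<le> s \<Longrightarrow> s \<le> t \<Longrightarrow> sets (F s) \<subseteq> sets (F t)"
    and adapted_W: "\<And>t. 0 \<le> t \<Longrightarrow> W t \<in> borel_measurable (F t)"
    and start_W: "AE \<omega> in \<Omega>. W 0 \<omega> = 0"
    and continuous_W: "AE \<omega> in \<Omega>. continuous_on {0..} (\<lambda>t. W t \<omega>)"
    and increments_W: "\<And>s t. 0 \<le> s \<Longrightarrow> s < t \<Longrightarrow>
      distributed \<Omega> lborel (\<lambda>\<omega>. W t \<omega> - W s \<omega>) (normal_density 0 (sqrt (t - s)))"
    and indep_increments_W: "\<And>s t. 0 \<le> s \<Longrightarrow> s < t \<Longrightarrow>
      indep_set (sets (F s))
        {(\<lambda>\<omega>. W t \<omega> - W s \<omega>) -` S \<inter> space \<Omega> | S. S \<in> sets borel}"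

text \<open>The data \<open>k, \<tau>, \<xi>\<close> encode the simple process equal to \<open>\<xi> i\<close> on \<open>(\<tau> i, \<tau> (i + 1)]\<close>
  for \<open>i < k\<close> and to \<open>0\<close> elsewhere.\<close>

definition simple_data ::
  "'w measure \<Rightarrow> (real \<Rightarrow> 'w measure) \<Rightarrow> real \<Rightarrow> nat \<Rightarrow> (nat \<Rightarrow> real) \<Rightarrow>
    (nat \<Rightarrow> 'w \<Rightarrow> 'b::euclidean_space) \<Rightarrow> bool" where
  "simple_data \<Omega> F T k \<tau> \<xi> \<longleftrightarrow>
     0 \<le> \<tau> 0 \<and> (\<forall>i<k. \<tau> i \<le> \<tau> (Suc i)) \<and> \<tau> k \<le> T \<and>
     (\<forall>i<k. \<xi> i \<in> borel_measurable (F (\<tau> i)) \<and> bounded (\<xi> i ` space \<Omega>))"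

definition simple_process ::
  "nat \<Rightarrow> (nat \<Rightarrow> real) \<Rightarrow> (nat \<Rightarrow> 'w \<Rightarrow> 'b::euclidean_space) \<Rightarrow> real \<Rightarrow> 'w \<Rightarrow> 'b" where
  "simple_process k \<tau> \<xi> t \<omega> = (\<Sum>i<k. indicator {\<tau> i<..\<tau> (Suc i)} t *\<^sub>R \<xi> i \<omega>)"

definition simple_integral ::
  "(real \<Rightarrow> 'w \<Rightarrow> real) \<Rightarrow> nat \<Rightarrow> (nat \<Rightarrow> real) \<Rightarrow> (nat \<Rightarrow> 'w \<Rightarrow> 'b::euclidean_space) \<Rightarrow> 'w \<Rightarrow> 'b"
  where
  "simple_integral W k \<tau> \<xi> \<omega> = (\<Sum>i<k. (W (\<tau> (Suc i)) \<omega> - W (\<tau> i) \<omega>) *\<^sub>R \<xi> i \<omega>)"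

text \<open>\<open>I\<close> is (a version of) the Ito integral of \<open>f\<close> over \<open>[0, T]\<close>: the mean-square limit of
  the integrals of simple processes approximating \<open>f\<close> in \<open>L\<^sup>2([0, T] \<times> \<Omega>)\<close>.\<close>

definition has_ito_integral ::
  "'w measure \<Rightarrow> (real \<Rightarrow> 'w measure) \<Rightarrow> (real \<Rightarrow> 'w \<Rightarrow> real) \<Rightarrow> real \<Rightarrow>
    (real \<Rightarrow> 'w \<Rightarrow> 'b::euclidean_space) \<Rightarrow> ('w \<Rightarrow> 'b) \<Rightarrow> bool" where
  "has_ito_integral \<Omega> F W T f I \<longleftrightarrow>
     (\<lambda>(t, \<omega>). f t \<omega>) \<in> borel_measurable (restrict_space lborel {0..T} \<Otimes>\<^sub>M \<Omega>) \<and>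
     I \<in> borel_measurable \<Omega> \<and>
     (\<exists>k \<tau> \<xi>. (\<forall>m. simple_data \<Omega> F T (k m) (\<tau> m) (\<xi> m)) \<and>
        (\<lambda>m. \<integral>\<^sup>+\<omega>. (\<integral>\<^sup>+t\<in>{0..T}.
            ennreal ((norm (f t \<omega> - simple_process (k m) (\<tau> m) (\<xi> m) t \<omega>))\<^sup>2) \<partial>lborel) \<partial>\<Omega>)
          \<longlonglongrightarrow> 0 \<and>
        (\<lambda>m. \<integral>\<^sup>+\<omega>. ennreal ((norm (I \<omega> - simple_integral W (k m) (\<tau> m) (\<xi> m) \<omega>))\<^sup>2) \<partial>\<Omega>)
          \<longlonglongrightarrow> 0)"

text \<open>Strong solutions of \<open>dx = A x dt + C x dW\<close>, \<open>x(0) = x0\<close>, with continuous paths, in the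
  class \<open>E \<integral>\<^sub>0\<^sup>T |x|\<^sup>2 dt < \<infinity>\<close> for every \<open>T\<close>. In this class the solution is unique up to
  indistinguishability. Continuity of every path, rather than of almost every path, is no
  restriction when \<open>F 0\<close> contains all null sets.\<close>

definition linear_sde_solution ::
  "'w measure \<Rightarrow> (real \<Rightarrow> 'w measure) \<Rightarrow> (real \<Rightarrow> 'w \<Rightarrow> real) \<Rightarrow>
    real^'n^'n \<Rightarrow> real^'n^'n \<Rightarrow> real^'n \<Rightarrow> (real \<Rightarrow> 'w \<Rightarrow> real^'n) \<Rightarrow> bool" where
  "linear_sde_solution \<Omega> F W A C x0 x \<longleftrightarrow>
     (\<forall>t\<ge>0. x t \<in> borel_measurable (F t)) \<and>
     (\<forall>\<omega>\<in>space \<Omega>. continuous_on {0..} (\<lambda>t. x t \<omega>)) \<and>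
     (\<forall>T\<ge>0. (\<integral>\<^sup>+\<omega>. (\<integral>\<^sup>+t\<in>{0..T}. ennreal ((norm (x t \<omega>))\<^sup>2) \<partial>lborel) \<partial>\<Omega>) < \<infinity>) \<and>
     (\<forall>t\<ge>0. \<exists>I. has_ito_integral \<Omega> F W t (\<lambda>s \<omega>. C *v x s \<omega>) I \<and>
        (AE \<omega> in \<Omega>. x t \<omega> = x0 + (LINT s:{0..t}|lborel. A *v x s \<omega>) + I \<omega>))"

section \<open>Stabilizability, detectability and the weighted function space\<close>

text \<open>By existence and uniqueness for linear equations, \<open>\<exists>x\<close> refers to the solution
  of the closed-loop equation.\<close>

definition discounted_stabilizable ::
  "'w measure \<Rightarrow> (real \<Rightarrow> 'w measure) \<Rightarrow> (real \<Rightarrow> 'w \<Rightarrow> real) \<Rightarrow> real \<Rightarrow>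
    real^'n^'n \<Rightarrow> real^'r^'n \<Rightarrow> real^'n^'n \<Rightarrow> real^'r^'n \<Rightarrow> bool" where
  "discounted_stabilizable \<Omega> F W \<rho> A B C D \<longleftrightarrow>
     (\<exists>K :: real^'n^'r. \<forall>x0. \<exists>x.
        linear_sde_solution \<Omega> F W (A + B ** K) (C + D ** K) x0 x \<and>
        (\<integral>\<^sup>+\<omega>. (\<integral>\<^sup>+t\<in>{0..}. ennreal (exp (- \<rho> * t) * (norm (x t \<omega>))\<^sup>2) \<partial>lborel) \<partial>\<Omega>) < \<infinity>)"

definition exactly_detectable ::
  "'w measure \<Rightarrow> (real \<Rightarrow> 'w measure) \<Rightarrow> (real \<Rightarrow> 'w \<Rightarrow> real) \<Rightarrow>
    real^'n^'n \<Rightarrow> real^'n^'n \<Rightarrow> real^'n^'n \<Rightarrow> bool" where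
  "exactly_detectable \<Omega> F W A C H \<longleftrightarrow>
     (\<forall>z0 z. linear_sde_solution \<Omega> F W A C z0 z \<longrightarrow>
        (\<forall>T>0. \<forall>t\<in>{0..T}. AE \<omega> in \<Omega>. H *v z t \<omega> = 0) \<longrightarrow>
        ((\<lambda>t. \<integral>\<^sup>+\<omega>. ennreal ((norm (z t \<omega>))\<^sup>2) \<partial>\<Omega>) \<longlongrightarrow> 0) at_top)"

text \<open>The space \<open>C\<^bsub>\<rho>/2\<^esub>([0, \<infinity>), V)\<close>; values at negative arguments are ignored.\<close>

definition C_half :: "real \<Rightarrow> (real \<Rightarrow> 'v::{real_normed_vector, second_countable_topology}) set"
  where
  "C_half \<rho> = {f. continuous_on {0..} f \<and>
     set_integrable lborel {0..} (\<lambda>t. exp (- \<rho> * t) * (norm (f t))\<^sup>2)}"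

text \<open>\<open>G\<close> stands for \<open>B (R + D\<^sup>T P D)\<^sup>-\<^sup>1 B\<^sup>T\<close>. The norm on pairs is the Euclidean norm of
  \<open>\<real>\<^sup>2\<^sup>n\<close>.\<close>

definition mean_field_solution ::
  "real \<Rightarrow> real^'n^'n \<Rightarrow> real^'n^'n \<Rightarrow> real^'n^'n \<Rightarrow> real^'n \<Rightarrow>
    (real \<Rightarrow> real^'n) \<Rightarrow> (real \<Rightarrow> real^'n) \<Rightarrow> bool" where
  "mean_field_solution \<rho> Abar G Q x0 s x \<longleftrightarrow>
     (\<lambda>t. (s t, x t)) \<in> C_half \<rho> \<and> x 0 = x0 \<and>
     (\<forall>t\<ge>0. \<exists>ds. (s has_vector_derivative ds) (at t within {0..}) \<and>
        \<rho> *\<^sub>R s t = ds + transpose Abar *v s t - Q *v x t) \<and>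
     (\<forall>t\<ge>0. (x has_vector_derivative (Abar *v x t - G *v s t)) (at t within {0..}))"

end

theory Submission
  imports Defs "HOL-Computational_Algebra.Fundamental_Theorem_Algebra" "HOL-Real_Asymp.Real_Asymp"
begin

text \<open>After discounting by \<open>exp (- \<rho> t / 2)\<close> and replacing \<open>s\<close> by \<open>- s\<close>, the system is the linear flow
  of the Hamiltonian matrix \<open>M\<close>. Since \<open>M\<close> has no imaginary eigenvalues, \<open>\<complex>\<^sup>2\<^sup>n\<close> is the direct sum of
  the stable and the unstable space of \<open>M\<close>; both are isotropic for the symplectic form, so the
  stable space is its own symplectic complement. A vector \<open>(0, q)\<close> in the stable space
  forces \<open>q\<^sup>* G q = 0\<close>, so a nonzero one would yield a left eigenvector of \<open>A - \<rho>/2 I\<close>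
  with positive real part that is killed by \<open>B\<close>. The mean of a closed-loop solution grows along such
  a left eigenvector, which contradicts stabilizability. Hence the stable space meets
  \<open>0 \<times> \<complex>\<^sup>n\<close> trivially, and by duality it projects onto the first component: every initial state
  is the start of a decaying trajectory. Uniqueness follows by pairing the difference
  of two solutions symplectically with such a trajectory.\<close>

section \<open>Spectral decomposition of a complex matrix\<close>

text \<open>The absence of imaginary eigenvalues does not suffice: in dimension one with
  \<open>N = 1\<close> and \<open>G = Q = 0\<close> the stable space is the second coordinate axis,
  so no nonzero initial state has a decaying trajectory. Stabilizability excludes this as a Hautus
  test. A left eigenvector killed by \<open>B\<close> belongs to \<open>Abar\<close> and to every
  \<open>A + B K\<close> with the same eigenvalue, because these matrices differ only by terms of
  the form \<open>B L\<close>; so the unknown gain and the gain inside \<open>Abar\<close> both drop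
  out. Undoing the shift by \<open>\<rho> / 2\<close>, the mean along it grows faster than
  \<open>exp (\<rho> t / 2)\<close>, and its square outweighs the discount. The noise enters only
  through the vanishing mean of Ito integrals.

  Generalized eigenspaces are handled without Jordan form or multiplicities:
  \<open>prod_shift H L z\<close> applies the factors \<open>H - l\<close>, for \<open>l\<close> in
  \<open>L\<close>, to \<open>z\<close>. Lists may repeat entries and may contain numbers that are
  not eigenvalues, and the arguments become inductions that peel off one factor. Maximal isotropy
  takes the place of dimension counts.\<close>

primrec prod_shift :: "complex^'m^'m \<Rightarrow> complex list \<Rightarrow> complex^'m \<Rightarrow> complex^'m" where
  "prod_shift H [] z = z"
| "prod_shift H (l # L) z = prod_shift H L (H *v z - l *s z)"

lemma shift_scaleC:
  fixes H :: "complex^'m^'m"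
  shows "H *v (c *s z) - l *s (c *s z) = c *s (H *v z - l *s z)"
  by (simp add: vector_scalar_commute vector_smult_assoc mult.commute vec.scale_right_diff_distrib)

lemma shift_add:
  fixes H :: "complex^'m^'m"
  shows "H *v (z + w) - l *s (z + w) = (H *v z - l *s z) + (H *v w - l *s w)"
  by (simp add: matrix_vector_right_distrib vec.scale_right_distrib)

lemma prod_shift_add: "prod_shift H L (z + w) = prod_shift H L z + prod_shift H L w"
  by (induction L arbitrary: z w) (simp_all only: prod_shift.simps shift_add)

lemma prod_shift_scale: "prod_shift H L (c *s z) = c *s prod_shift H L z"
  by (induction L arbitrary: z) (simp_all only: prod_shift.simps shift_scaleC)

lemma prod_shift_zero [simp]: "prod_shift H L 0 = 0"
  using prod_shift_scale[of H L 0 0] by simp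

lemma prod_shift_diff: "prod_shift H L (z - w) = prod_shift H L z - prod_shift H L w"
  using prod_shift_add[of H L "z - w" w] by simp

lemma shift_mult:
  fixes H :: "complex^'m^'m"
  shows "H *v (H *v z) - l *s (H *v z) = H *v (H *v z - l *s z)"
  by (simp add: matrix_vector_mult_diff_distrib vector_scalar_commute)

lemma prod_shift_mult: "prod_shift H L (H *v z) = H *v prod_shift H L z"
  by (induction L arbitrary: z) (simp_all only: prod_shift.simps shift_mult)

lemma prod_shift_shift: "prod_shift H L (H *v z - l *s z) = H *v prod_shift H L z - l *s prod_shift H L z"
  by (simp add: prod_shift_diff prod_shift_mult prod_shift_scale)

lemma prod_shift_append: "prod_shift H (L @ L') z = prod_shift H L' (prod_shift H L z)"
  by (induction L arbitrary: z) simp_all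

text \<open>All factors are polynomials in \<open>H\<close>. Commutation is what lets a concatenated
  list kill everything that either of its parts kills.\<close>

lemma prod_shift_commute: "prod_shift H L (prod_shift H L' z) = prod_shift H L' (prod_shift H L z)"
  by (induction L arbitrary: z) (simp_all only: prod_shift.simps prod_shift_shift[symmetric])

lemma prod_shift_mono:
  assumes "prod_shift H L z = 0"
  shows "prod_shift H (L @ L') z = 0" "prod_shift H (L' @ L) z = 0"
  using assms prod_shift_commute[of H L L' z] by (simp_all add: prod_shift_append)

text \<open>The hypothesis says that the polynomial \<open>p\<close> in \<open>H\<close> kills
  \<open>z\<close>. Over the complex numbers \<open>p\<close> has a root \<open>l\<close>; the
  quotient by \<open>X - l\<close> then kills \<open>H z - l z\<close>, and the degree has dropped
  by one.\<close>

lemma prod_shift_eq_0_if_poly: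
  fixes H :: "complex^'m^'m"
  assumes "p \<noteq> 0" "degree p \<le> n" "(\<Sum>i\<le>n. coeff p i *s (((*v) H ^^ i) z)) = 0"
  shows "\<exists>L. prod_shift H L z = 0"
  using assms
proof (induction n arbitrary: p z)
  case 0
  then have "coeff p 0 *s z = 0" "coeff p 0 \<noteq> 0"
    using leading_coeff_0_iff[of p] by auto
  then have "prod_shift H [] z = 0" by simp
  then show ?case by blast
next
  case (Suc n)
  show ?case
  proof (cases "degree p = 0")
    case True
    then have "coeff p i = 0" if "i \<noteq> 0" for i
      using that by (simp add: coeff_eq_0)
    then have "(\<Sum>i\<le>Suc n. coeff p i *s (((*v) H ^^ i) z)) = (\<Sum>i\<in>{0}. coeff p i *s (((*v) H ^^ i) z))"
      by (intro sum.mono_neutral_right) auto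
    with Suc.prems(3) have "coeff p 0 *s z = 0" by simp
    moreover have "coeff p 0 \<noteq> 0" using True Suc.prems(1) leading_coeff_0_iff[of p] by simp
    ultimately have "prod_shift H [] z = 0" by simp
    then show ?thesis by blast
  next
    case False
    then obtain l where "poly p l = 0"
      using fundamental_theorem_of_algebra[of p] constant_degree[of p] by auto
    then obtain q where q: "p = [:- l, 1:] * q"
      using poly_eq_0_iff_dvd[of p l] by (auto elim: dvdE)
    have q0: "q \<noteq> 0" using Suc.prems(1) q by auto
    have dq: "degree p = Suc (degree q)" unfolding q using q0 by (subst degree_mult_eq) auto
    have c: "coeff p i = (case i of 0 \<Rightarrow> 0 | Suc j \<Rightarrow> coeff q j) - l * coeff q i" for i
      unfolding q by (simp add: coeff_pCons)
    let ?h = "\<lambda>i. ((*v) H ^^ i)"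
    have lin: "?h i (H *v z - l *s z) = ?h (Suc i) z - l *s ?h i z" for i
      by (induction i)
        (simp_all add: matrix_vector_mult_diff_distrib vector_scalar_commute)
    have "(\<Sum>i\<le>n. coeff q i *s ?h i (H *v z - l *s z))
        = (\<Sum>i\<le>n. coeff q i *s ?h (Suc i) z) - (\<Sum>i\<le>n. (l * coeff q i) *s ?h i z)"
      by (simp add: lin vec.scale_right_diff_distrib sum_subtractf vector_smult_assoc mult.commute
          del: funpow.simps)
    \<comment> \<open>The added top term vanishes since \<open>degree q \<le> n\<close>. It gives
      this sum the same range as the index-shifted one, so that the two combine into the
      coefficients of \<open>p\<close>.\<close>
    also have "(\<Sum>i\<le>n. (l * coeff q i) *s ?h i z) = (\<Sum>i\<le>Suc n. (l * coeff q i) *s ?h i z)"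
      using dq Suc.prems(2) by (simp add: coeff_eq_0)
    also have "(\<Sum>i\<le>n. coeff q i *s ?h (Suc i) z)
        = (\<Sum>i\<le>Suc n. (case i of 0 \<Rightarrow> 0 | Suc j \<Rightarrow> coeff q j) *s ?h i z)"
      by (subst sum.atMost_Suc_shift) simp
    also have "\<dots> - (\<Sum>i\<le>Suc n. (l * coeff q i) *s ?h i z) = (\<Sum>i\<le>Suc n. coeff p i *s ?h i z)"
      by (simp only: c vec.scale_left_diff_distrib sum_subtractf)
    finally have "(\<Sum>i\<le>n. coeff q i *s ?h i (H *v z - l *s z)) = 0"
      using Suc.prems(3) by simp
    then obtain L where "prod_shift H L (H *v z - l *s z) = 0"
      using Suc.IH[OF q0, of "H *v z - l *s z"] dq Suc.prems(2) by auto
    then have "prod_shift H (l # L) z = 0" by simp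
    then show ?thesis by blast
  qed
qed

text \<open>The Krylov vectors \<open>z\<close>, \<open>H z\<close>, ..., up to the power
  \<open>CARD('m)\<close> are one more than the dimension, so a nontrivial relation between them is
  a nonzero polynomial in \<open>H\<close> that kills \<open>z\<close>.\<close>

lemma ex_prod_shift_eq_0:
  fixes H :: "complex^'m^'m"
  shows "\<exists>L. prod_shift H L z = 0"
proof -
  let ?h = "\<lambda>i. ((*v) H ^^ i) z"
  let ?n = "CARD('m)"
  have "\<exists>c. (\<exists>i\<le>?n. c i \<noteq> 0) \<and> (\<Sum>i\<le>?n. c i *s ?h i) = 0"
  proof (cases "inj_on ?h {..?n}")
    case True
    then have "card (?h ` {..?n}) > vec.dim (?h ` {..?n})"
      using vec.dim_subset_UNIV[of "?h ` {..?n}"]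
      by (simp add: card_image le_imp_less_Suc card_cart_basis vec.dimension_def)
    then have "vec.dependent (?h ` {..?n})"
      using vec.dim_eq_card_independent by force
    then obtain u where u: "\<exists>v\<in>?h ` {..?n}. u v \<noteq> 0" "(\<Sum>v\<in>?h ` {..?n}. u v *s v) = 0"
      by (subst (asm) vec.dependent_finite) auto
    then show ?thesis
      using True by (intro exI[of _ "\<lambda>i. u (?h i)"] conjI) (auto simp only: sum.reindex o_def image_iff atMost_iff)
  next
    \<comment> \<open>Linear dependence concerns sets, so a repeated Krylov vector would go
      unnoticed there; the repetition itself is the relation, with coefficients 1 and -1.\<close>
    case False
    then obtain i j where ij: "i \<le> ?n" "j \<le> ?n" "i \<noteq> j" "?h i = ?h j"
      by (auto simp: inj_on_def)
    let ?c = "\<lambda>k. (if k = i then 1 else 0) - (if k = j then 1 else 0 :: complex)"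
    have delta: "(\<Sum>k\<le>?n. (if k = a then 1 else 0) *s ?h k) = ?h a" if "a \<le> ?n" for a
    proof -
      have "(\<Sum>k\<le>?n. (if k = a then 1 else 0) *s ?h k) = (\<Sum>k\<le>?n. if k = a then ?h k else 0)"
        by (rule sum.cong) auto
      also have "\<dots> = ?h a" using that by (simp only: sum.delta finite_atMost atMost_iff if_True)
      finally show ?thesis .
    qed
    have "(\<Sum>k\<le>?n. ?c k *s ?h k) = ?h i - ?h j"
      by (simp only: vec.scale_left_diff_distrib sum_subtractf delta ij(1,2))
    then have "(\<Sum>k\<le>?n. ?c k *s ?h k) = 0" using ij(4) by simp
    moreover have "?c i \<noteq> 0" using ij(3) by simp
    ultimately show ?thesis using ij(1) by (intro exI[of _ ?c] conjI) auto
  qed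
  then obtain c i where c: "i \<le> ?n" "c i \<noteq> 0" "(\<Sum>i\<le>?n. c i *s ?h i) = 0" by blast
  define p where "p = (\<Sum>i\<le>?n. monom (c i) i)"
  have cp: "coeff p k = (if k \<le> ?n then c k else 0)" for k
    by (simp add: p_def coeff_sum)
  have "p \<noteq> 0" using cp[of i] c(1,2) by auto
  moreover have "degree p \<le> ?n" by (rule degree_le) (simp add: cp)
  moreover have "(\<Sum>i\<le>?n. coeff p i *s ?h i) = 0" using c(3) by (simp add: cp)
  ultimately show ?thesis by (rule prod_shift_eq_0_if_poly)
qed

text \<open>Applying the factors one by one, the last nonzero vector is an eigenvector for the next
  entry of the list. Closure of \<open>S\<close> under shifts keeps it in \<open>S\<close>.\<close>

lemma ex_eigenvector_if_prod_shift_eq_0: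
  assumes "prod_shift H L z = 0" "z \<noteq> 0" "z \<in> S" "\<And>l w. w \<in> S \<Longrightarrow> H *v w - l *s w \<in> S"
  shows "\<exists>l\<in>set L. \<exists>v\<in>S. v \<noteq> 0 \<and> H *v v = l *s v"
  using assms(1-3)
proof (induction L arbitrary: z)
  case (Cons l L)
  show ?case
  proof (cases "H *v z - l *s z = 0")
    case True
    then show ?thesis
      using Cons.prems(2,3) by (intro bexI[of _ l] bexI[of _ z]) simp_all
  next
    case False
    have "prod_shift H L (H *v z - l *s z) = 0" using Cons.prems(1) by simp
    from Cons.IH[OF this False assms(4)[OF Cons.prems(3)]] show ?thesis by auto
  qed
qed simp

text \<open>On the space killed by the factors in \<open>L\<close>, the map \<open>H - l\<close> is
  onto when \<open>l\<close> is not among them. This replaces the Bezout identity in the primary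
  decomposition.\<close>

lemma shift_solvable:
  assumes "prod_shift H L w = 0" "l \<notin> set L"
  shows "\<exists>z. H *v z - l *s z = w \<and> prod_shift H L z = 0"
  using assms
proof (induction L arbitrary: w)
  case Nil
  then show ?case by (intro exI[of _ 0]) simp
next
  case (Cons m L)
  then obtain y where y: "H *v y - l *s y = H *v w - m *s w" "prod_shift H L y = 0" by auto
  have lm: "l - m \<noteq> 0" using Cons.prems by auto
  \<comment> \<open>Since \<open>(H - l) y = (H - m) w\<close>, subtracting \<open>(H - l) w\<close>
    leaves \<open>(l - m) w\<close>; division by \<open>l - m\<close> gives the solution.\<close>
  define z where "z = (1 / (l - m)) *s (y - w)"
  have "H *v z - l *s z = (1 / (l - m)) *s ((H *v y - l *s y) - (H *v w - l *s w))"
    unfolding z_def shift_scaleC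
    by (simp add: matrix_vector_mult_diff_distrib vec.scale_right_diff_distrib algebra_simps)
  also have "\<dots> = (1 / (l - m)) *s ((l - m) *s w)"
    unfolding y by (simp add: vec.scale_left_diff_distrib)
  also have "\<dots> = w" using lm by (simp only: vector_smult_assoc) simp
  finally have "H *v z - l *s z = w" .
  moreover have "prod_shift H (m # L) z = 0"
  proof -
    have "prod_shift H (m # L) z = (1 / (l - m)) *s (prod_shift H (m # L) y - prod_shift H (m # L) w)"
      unfolding z_def prod_shift_scale prod_shift_diff ..
    also have "prod_shift H (m # L) y = 0" using y(2) by (simp add: prod_shift_shift)
    finally show ?thesis using Cons.prems by simp
  qed
  ultimately show ?case by blast
qed

text \<open>The induction hypothesis splits \<open>(H - l) z\<close>. The component whose list lacks
  \<open>l\<close> is lifted back through \<open>H - l\<close> inside its own space; the remainder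
  of \<open>z\<close> is then killed by the other list extended by \<open>l\<close>.\<close>

lemma prod_shift_split:
  assumes "prod_shift H L z = 0"
  shows "\<exists>z1 z2. z = z1 + z2 \<and> prod_shift H (filter P L) z1 = 0 \<and> prod_shift H (filter (\<lambda>l. \<not> P l) L) z2 = 0"
  using assms
proof (induction L arbitrary: z)
  case Nil
  then show ?case by (intro exI[of _ 0]) simp
next
  case (Cons l L)
  from Cons.prems have "prod_shift H L (H *v z - l *s z) = 0" by simp
  from Cons.IH[OF this] obtain w1 w2 where w: "H *v z - l *s z = w1 + w2"
      "prod_shift H (filter P L) w1 = 0" "prod_shift H (filter (\<lambda>l. \<not> P l) L) w2 = 0"
    by blast
  show ?case
  proof (cases "P l")
    case True
    then obtain z2 where z2: "H *v z2 - l *s z2 = w2" "prod_shift H (filter (\<lambda>l. \<not> P l) L) z2 = 0"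
      using shift_solvable[OF w(3), of l] by auto
    have "H *v (z - z2) - l *s (z - z2) = w1"
      using w(1) z2(1) shift_add[of H "z - z2" z2 l] by simp
    then show ?thesis
      using True w z2 by (intro exI[of _ "z - z2"] exI[of _ z2]) auto
  next
    case False
    then obtain z1 where z1: "H *v z1 - l *s z1 = w1" "prod_shift H (filter P L) z1 = 0"
      using shift_solvable[OF w(2), of l] by auto
    have "H *v (z - z1) - l *s (z - z1) = w2"
      using w(1) z1(1) shift_add[of H "z - z1" z1 l] by simp
    then show ?thesis
      using False w z1 by (intro exI[of _ "z1"] exI[of _ "z - z1"]) auto
  qed
qed

text \<open>The sum of the generalized eigenspaces for the eigenvalues satisfying \<open>P\<close>.
  The list is existential, so sums of vectors need only concatenation of lists.\<close>

definition spectral_space :: "(complex \<Rightarrow> bool) \<Rightarrow> complex^'m^'m \<Rightarrow> (complex^'m) set" where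
  "spectral_space P H = {z. \<exists>L. (\<forall>l\<in>set L. P l) \<and> prod_shift H L z = 0}"

lemma spectral_space_add:
  assumes "z \<in> spectral_space P H" "w \<in> spectral_space P H"
  shows "z + w \<in> spectral_space P H"
proof -
  from assms obtain L L' where L: "\<forall>l\<in>set L. P l" "prod_shift H L z = 0" "\<forall>l\<in>set L'. P l" "prod_shift H L' w = 0"
    by (auto simp: spectral_space_def)
  then have "prod_shift H (L @ L') (z + w) = 0" by (simp add: prod_shift_add prod_shift_mono)
  moreover have "\<forall>l\<in>set (L @ L'). P l" using L by auto
  ultimately show ?thesis unfolding spectral_space_def by blast
qed

lemma spectral_space_scale:
  assumes "z \<in> spectral_space P H"
  shows "c *s z \<in> spectral_space P H"
proof -
  from assms obtain L where L: "\<forall>l\<in>set L. P l" "prod_shift H L z = 0"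
    by (auto simp: spectral_space_def)
  from L(2) have "prod_shift H L (c *s z) = 0" by (simp add: prod_shift_scale)
  with L(1) show ?thesis unfolding spectral_space_def by blast
qed

lemma spectral_space_mult:
  assumes "z \<in> spectral_space P H"
  shows "H *v z \<in> spectral_space P H"
proof -
  from assms obtain L where L: "\<forall>l\<in>set L. P l" "prod_shift H L z = 0"
    by (auto simp: spectral_space_def)
  from L(2) have "prod_shift H L (H *v z) = 0" by (simp add: prod_shift_mult)
  with L(1) show ?thesis unfolding spectral_space_def by blast
qed

lemma zero_spectral_space: "0 \<in> spectral_space P H"
  unfolding spectral_space_def by (intro CollectI exI[of _ "[]"]) simp

lemma spectral_space_shift:
  "z \<in> spectral_space P H \<Longrightarrow> H *v z - l *s z \<in> spectral_space P H"
  using spectral_space_add[OF spectral_space_mult spectral_space_scale, of z P H z "- l"]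
  by simp

lemma spectral_split:
  assumes "\<And>l v. v \<noteq> 0 \<Longrightarrow> H *v v = l *s v \<Longrightarrow> Re l \<noteq> 0"
  shows "\<exists>z1\<in>spectral_space (\<lambda>l. Re l < 0) H. \<exists>z2\<in>spectral_space (\<lambda>l. Re l > 0) H. z = z1 + z2"
proof -
  obtain L where L: "prod_shift H L z = 0" using ex_prod_shift_eq_0 by blast
  obtain x y where xy: "z = x + y" "prod_shift H (filter (\<lambda>l. Re l = 0) L) x = 0"
      "prod_shift H (filter (\<lambda>l. Re l \<noteq> 0) L) y = 0"
    using prod_shift_split[OF L, of "\<lambda>l. Re l = 0"] by blast
  \<comment> \<open>The list \<open>L\<close> may contain imaginary numbers although no eigenvalue
    is imaginary. The part that they kill is zero, since otherwise it would contain an eigenvector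
    for one of them.\<close>
  have "x = 0"
  proof (rule ccontr)
    assume "x \<noteq> 0"
    from ex_eigenvector_if_prod_shift_eq_0[OF xy(2) this, of UNIV] assms show False by auto
  qed
  obtain z1 z2 where z: "y = z1 + z2" "prod_shift H (filter (\<lambda>l. Re l < 0) (filter (\<lambda>l. Re l \<noteq> 0) L)) z1 = 0"
      "prod_shift H (filter (\<lambda>l. \<not> Re l < 0) (filter (\<lambda>l. Re l \<noteq> 0) L)) z2 = 0"
    using prod_shift_split[OF xy(3), of "\<lambda>l. Re l < 0"] by blast
  have "z1 \<in> spectral_space (\<lambda>l. Re l < 0) H"
    unfolding spectral_space_def using z(2) by force
  moreover have "z2 \<in> spectral_space (\<lambda>l. Re l > 0) H"
    unfolding spectral_space_def using z(3)
    by (intro CollectI exI[of _ "filter (\<lambda>l. \<not> Re l < 0) (filter (\<lambda>l. Re l \<noteq> 0) L)"]) auto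
  ultimately show ?thesis using xy(1) z(1) \<open>x = 0\<close> by auto
qed

text \<open>For eigenvectors, skewness gives \<open>(cnj l + m) * \<sigma> z1 z2 = 0\<close>. For
  general vectors the same identity holds once the pairings with one factor applied to either side
  vanish, which the nested induction over both lists supplies. Two numbers in the same open
  half-plane satisfy the condition on \<open>P\<close>.\<close>

lemma isotropic_if_skew:
  fixes H :: "complex^'m^'m" and \<sigma> :: "complex^'m \<Rightarrow> complex^'m \<Rightarrow> complex"
  assumes diff: "\<And>x y z. \<sigma> (x - y) z = \<sigma> x z - \<sigma> y z" "\<And>x y z. \<sigma> x (y - z) = \<sigma> x y - \<sigma> x z"
    and scale: "\<And>c x y. \<sigma> (c *s x) y = cnj c * \<sigma> x y" "\<And>c x y. \<sigma> x (c *s y) = c * \<sigma> x y"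
    and skew: "\<And>x y. \<sigma> (H *v x) y = - \<sigma> x (H *v y)"
    and z: "z1 \<in> spectral_space P H" "z2 \<in> spectral_space P H"
    and P: "\<And>l m. P l \<Longrightarrow> P m \<Longrightarrow> cnj l + m \<noteq> 0"
  shows "\<sigma> z1 z2 = 0"
proof -
  have *: "\<sigma> z1 z2 = 0" if "prod_shift H L1 z1 = 0" "prod_shift H L2 z2 = 0" "\<forall>l\<in>set L1. P l" "\<forall>l\<in>set L2. P l" for L1 L2
    using that
  proof (induction L1 arbitrary: z1 z2 L2)
    case Nil
    then show ?case using scale(1)[of 0 0 z2] by simp
  next
    case (Cons l L1)
    \<comment> \<open>The outer hypothesis shortens the first list and holds for every second list;
      the inner induction shortens the second list while the first stays fixed.\<close>
    note IH1 = Cons.IH and p1 = Cons.prems(1,3)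
    from Cons.prems(2,4) show ?case
    proof (induction L2 arbitrary: z2)
      case Nil
      then show ?case using scale(2)[of z1 0 0] by simp
    next
      case (Cons m L2)
      have "\<sigma> (H *v z1 - l *s z1) z2 = 0"
        using IH1[of "H *v z1 - l *s z1" "m # L2" z2] p1 Cons.prems by auto
      moreover have "\<sigma> z1 (H *v z2 - m *s z2) = 0"
        using Cons.IH[of "H *v z2 - m *s z2"] Cons.prems by auto
      ultimately have "- \<sigma> z1 (H *v z2) = cnj l * \<sigma> z1 z2" "\<sigma> z1 (H *v z2) = m * \<sigma> z1 z2"
        by (simp_all only: diff scale skew right_minus_eq)
      then have "(cnj l + m) * \<sigma> z1 z2 = - \<sigma> z1 (H *v z2) + \<sigma> z1 (H *v z2)"
        by (simp only: distrib_right)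
      then have "(cnj l + m) * \<sigma> z1 z2 = 0" by simp
      with P[of l m] p1 Cons.prems show ?case by simp
    qed
  qed
  from z show ?thesis unfolding spectral_space_def using * by blast
qed

section \<open>The stable space of a Hamiltonian matrix\<close>

abbreviation complex_matrix :: "real^'n^'m \<Rightarrow> complex^'n^'m" where
  "complex_matrix \<equiv> map_matrix complex_of_real"

definition hermitian_dot :: "complex^'n \<Rightarrow> complex^'n \<Rightarrow> complex" where
  "hermitian_dot a b = (\<Sum>i\<in>UNIV. cnj (a $ i) * b $ i)"

lemma hermitian_dot_simps:
  "hermitian_dot (a + a') b = hermitian_dot a b + hermitian_dot a' b"
  "hermitian_dot a (b + b') = hermitian_dot a b + hermitian_dot a b'"
  "hermitian_dot (a - a') b = hermitian_dot a b - hermitian_dot a' b"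
  "hermitian_dot a (b - b') = hermitian_dot a b - hermitian_dot a b'"
  "hermitian_dot (- a) b = - hermitian_dot a b"
  "hermitian_dot a (- b) = - hermitian_dot a b"
  "hermitian_dot (c *s a) b = cnj c * hermitian_dot a b"
  "hermitian_dot a (c *s b) = c * hermitian_dot a b"
  "hermitian_dot 0 b = 0" "hermitian_dot a 0 = 0"
  by (simp_all add: hermitian_dot_def algebra_simps sum.distrib sum_subtractf sum_negf sum_distrib_left)

lemma Re_hermitian_dot: "Re (hermitian_dot a b) = a \<bullet> b"
  by (simp add: hermitian_dot_def inner_vec_def inner_complex_def)

lemma hermitian_dot_complex_matrix:
  "hermitian_dot (complex_matrix S *v a) b = hermitian_dot a (complex_matrix (transpose S) *v b)"
proof -
  have "hermitian_dot (complex_matrix S *v a) b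
      = (\<Sum>i\<in>UNIV. \<Sum>j\<in>UNIV. complex_of_real (S $ i $ j) * cnj (a $ j) * b $ i)"
    by (simp add: hermitian_dot_def matrix_vector_mult_def map_matrix_def sum_distrib_right)
  also have "\<dots> = (\<Sum>j\<in>UNIV. \<Sum>i\<in>UNIV. complex_of_real (S $ i $ j) * cnj (a $ j) * b $ i)"
    by (rule sum.swap)
  also have "\<dots> = hermitian_dot a (complex_matrix (transpose S) *v b)"
    by (simp add: hermitian_dot_def matrix_vector_mult_def map_matrix_def transpose_def
        sum_distrib_left mult_ac)
  finally show ?thesis .
qed

definition Re_vec :: "complex^'n \<Rightarrow> real^'n" where "Re_vec z = (\<chi> i. Re (z $ i))"
definition Im_vec :: "complex^'n \<Rightarrow> real^'n" where "Im_vec z = (\<chi> i. Im (z $ i))"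

lemma Re_vec_mult: "Re_vec (complex_matrix S *v z) = S *v Re_vec z"
  and Im_vec_mult: "Im_vec (complex_matrix S *v z) = S *v Im_vec z"
  by (simp_all add: Re_vec_def Im_vec_def matrix_vector_mult_def map_matrix_def vec_eq_iff)

lemma inner_complex_vec: "a \<bullet> b = Re_vec a \<bullet> Re_vec b + Im_vec a \<bullet> Im_vec b"
  by (simp add: inner_vec_def inner_complex_def Re_vec_def Im_vec_def sum.distrib)

lemma Re_Im_vec_eq_0: "Re_vec z = 0 \<Longrightarrow> Im_vec z = 0 \<Longrightarrow> z = 0"
  by (simp add: vec_eq_iff Re_vec_def Im_vec_def complex_eq_iff)

lemma complex_matrix_uminus: "complex_matrix (- S) *v z = - (complex_matrix S *v z)"
  by (simp add: matrix_vector_mult_def map_matrix_def vec_eq_iff sum_negf)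

lemma pos_semidef_mult_eq_0:
  assumes S: "pos_semidef S" and 0: "x \<bullet> (S *v x) = 0"
  shows "S *v x = 0"
proof (rule ccontr)
  assume "S *v x \<noteq> 0"
  define y where "y = S *v x"
  define c where "c = y \<bullet> (S *v y)"
  define d where "d = y \<bullet> y"
  have d: "d > 0" using \<open>S *v x \<noteq> 0\<close> by (simp add: d_def y_def)
  have c: "c \<ge> 0" using S by (simp add: pos_semidef_def c_def)
  have xy: "x \<bullet> (S *v y) = d"
    using S transpose_matrix_vector[of S x]
    by (simp add: pos_semidef_def d_def y_def dot_lmul_matrix[symmetric, of x S])
  \<comment> \<open>A small negative step along \<open>S x\<close> would make the quadratic form
    negative. The denominator \<open>c + 1\<close> is positive even when \<open>c = 0\<close>, and
    it keeps \<open>t * c \<ge> - d\<close>.\<close>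
  define t where "t = - d / (c + 1)"
  have "0 \<le> (x + t *\<^sub>R y) \<bullet> (S *v (x + t *\<^sub>R y))"
    using S by (simp add: pos_semidef_def)
  also have "\<dots> = t * (2 * d + t * c)"
    using 0 xy by (simp add: matrix_vector_right_distrib matrix_vector_mult_scaleR inner_left_distrib
        inner_right_distrib c_def[symmetric] y_def[symmetric] d_def[symmetric] algebra_simps)
  finally have "0 \<le> t * (2 * d + t * c)" .
  moreover have "t < 0" using c d by (simp add: t_def)
  moreover have "2 * d + t * c > 0"
  proof -
    have "d * (c / (c + 1)) \<le> d * 1" using c d by (intro mult_left_mono) auto
    then have "t * c \<ge> - d" by (simp add: t_def)
    then show ?thesis using d by linarith
  qed
  ultimately show False by (simp add: zero_le_mult_iff)
qed

text \<open>For real symmetric \<open>S\<close> the Hermitian form is the sum of the real forms at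
  the real and imaginary parts; both are nonnegative, so both vanish.\<close>

lemma complex_pos_semidef_mult_eq_0:
  assumes S: "pos_semidef S" and 0: "hermitian_dot z (complex_matrix S *v z) = 0"
  shows "complex_matrix S *v z = 0"
proof -
  have "Re_vec z \<bullet> (S *v Re_vec z) + Im_vec z \<bullet> (S *v Im_vec z) = 0"
    using arg_cong[OF 0, of Re] by (simp add: Re_hermitian_dot inner_complex_vec Re_vec_mult Im_vec_mult)
  then have "Re_vec z \<bullet> (S *v Re_vec z) = 0" "Im_vec z \<bullet> (S *v Im_vec z) = 0"
    using S by (auto simp: pos_semidef_def add_nonneg_eq_0_iff)
  then have "S *v Re_vec z = 0" "S *v Im_vec z = 0"
    using pos_semidef_mult_eq_0[OF S] by auto
  then show ?thesis by (intro Re_Im_vec_eq_0) (simp_all add: Re_vec_mult Im_vec_mult)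
qed

section \<open>Block vectors and the symplectic form\<close>

definition fst_block :: "'a^('n::finite + 'm::finite) \<Rightarrow> 'a^'n" where "fst_block z = (\<chi> i. z $ Inl i)"
definition snd_block :: "'a^('n::finite + 'm::finite) \<Rightarrow> 'a^'m" where "snd_block z = (\<chi> i. z $ Inr i)"
definition join_block :: "'a^'n::finite \<Rightarrow> 'a^'m::finite \<Rightarrow> 'a^('n + 'm)" where
  "join_block a b = (\<chi> i. case i of Inl j \<Rightarrow> a $ j | Inr j \<Rightarrow> b $ j)"

lemma fst_block_simps:
  "fst_block (z + w) = fst_block z + fst_block w" "fst_block (z - w) = fst_block z - fst_block w"
  "fst_block (c *s z) = c *s fst_block z" "fst_block 0 = 0" "fst_block (join_block a b) = a"
  by (simp_all add: fst_block_def join_block_def vec_eq_iff)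

lemma snd_block_simps:
  "snd_block (z + w) = snd_block z + snd_block w" "snd_block (z - w) = snd_block z - snd_block w"
  "snd_block (c *s z) = c *s snd_block z" "snd_block 0 = 0" "snd_block (join_block a b) = b"
  by (simp_all add: snd_block_def join_block_def vec_eq_iff)

lemma block_eq_0: "fst_block z = 0 \<Longrightarrow> snd_block z = 0 \<Longrightarrow> z = 0"
  by (simp add: vec_eq_iff fst_block_def snd_block_def split_sum_all)

lemma sum_UNIV_sum:
  fixes f :: "'n::finite + 'm::finite \<Rightarrow> 'a::comm_monoid_add"
  shows "sum f UNIV = (\<Sum>i\<in>UNIV. f (Inl i)) + (\<Sum>i\<in>UNIV. f (Inr i))"
  using sum.Plus[of "UNIV :: 'n set" "UNIV :: 'm set" f] by (simp add: UNIV_Plus_UNIV)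

lemma block_mult:
  "fst_block (complex_matrix (block_matrix M11 M12 M21 M22) *v z)
     = complex_matrix M11 *v fst_block z + complex_matrix M12 *v snd_block z"
  "snd_block (complex_matrix (block_matrix M11 M12 M21 M22) *v z)
     = complex_matrix M21 *v fst_block z + complex_matrix M22 *v snd_block z"
  by (simp_all add: vec_eq_iff matrix_vector_mult_def map_matrix_def block_matrix_def fst_block_def
      snd_block_def sum_UNIV_sum)

text \<open>The standard symplectic form, extended sesquilinearly to complex vectors. Being
  conjugate-linear on the left, it pairs eigenvalues through \<open>cnj l + m\<close>, which
  separates the two half-planes.\<close>

definition symplectic :: "complex^('n::finite + 'n) \<Rightarrow> complex^('n + 'n) \<Rightarrow> complex" where
  "symplectic z w = hermitian_dot (fst_block z) (snd_block w) - hermitian_dot (snd_block z) (fst_block w)"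

lemma symplectic_simps:
  "symplectic (z + z') w = symplectic z w + symplectic z' w"
  "symplectic z (w + w') = symplectic z w + symplectic z w'"
  "symplectic (z - z') w = symplectic z w - symplectic z' w"
  "symplectic z (w - w') = symplectic z w - symplectic z w'"
  "symplectic (c *s z) w = cnj c * symplectic z w"
  "symplectic z (c *s w) = c * symplectic z w"
  by (simp_all add: symplectic_def hermitian_dot_simps fst_block_simps snd_block_simps algebra_simps)

lemma symplectic_nondegenerate:
  assumes "\<And>w. symplectic w z = 0"
  shows "z = 0"
proof -
  \<comment> \<open>The witness is \<open>z\<close> rotated by the symplectic matrix, which turns
    the pairing into the squared norm of \<open>z\<close>.\<close>
  have "symplectic (join_block (snd_block z) (- fst_block z)) z = 0" by (rule assms)
  then have "Re (symplectic (join_block (snd_block z) (- fst_block z)) z) = 0" by simp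
  then have "snd_block z \<bullet> snd_block z + fst_block z \<bullet> fst_block z = 0"
    by (simp add: symplectic_def fst_block_simps snd_block_simps hermitian_dot_simps Re_hermitian_dot)
  then have "snd_block z = 0" "fst_block z = 0" by (simp_all add: add_nonneg_eq_0_iff)
  then show ?thesis by (intro block_eq_0)
qed

text \<open>The stable space is Lagrangian. If its first components missed a direction
  \<open>b\<close>, then \<open>(0, b)\<close> would be symplectically orthogonal to it, hence
  inside it by maximality, contradicting the trivial intersection with the second coordinate
  space.\<close>

lemma spectral_space_fst_block_surj:
  fixes N G Q :: "real^'n^'n"
  defines "H \<equiv> complex_matrix (block_matrix N G (- Q) (- transpose N))"
  assumes G: "pos_semidef G" and Q: "transpose Q = Q"
    and no_imag: "\<And>l v. v \<noteq> 0 \<Longrightarrow> H *v v = l *s v \<Longrightarrow> Re l \<noteq> 0"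
    and stab: "\<And>l v. complex_matrix (transpose N) *v v = l *s v \<Longrightarrow> Re l > 0 \<Longrightarrow>
      complex_matrix G *v v = 0 \<Longrightarrow> v = 0"
  shows "\<exists>z\<in>spectral_space (\<lambda>l. Re l < 0) H. fst_block z = a"
proof -
  let ?S = "spectral_space (\<lambda>l. Re l < 0) H" and ?U = "spectral_space (\<lambda>l. Re l > 0) H"
  have skew: "symplectic (H *v x) y = - symplectic x (H *v y)" for x y
    using G Q
    by (simp add: H_def symplectic_def block_mult hermitian_dot_simps hermitian_dot_complex_matrix
        complex_matrix_uminus pos_semidef_def)
  have iso_S: "symplectic x y = 0" if "x \<in> ?S" "y \<in> ?S" for x y
    by (rule isotropic_if_skew[of symplectic, OF _ _ _ _ skew that])
      (auto simp: symplectic_simps complex_eq_iff)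
  have iso_U: "symplectic x y = 0" if "x \<in> ?U" "y \<in> ?U" for x y
    by (rule isotropic_if_skew[of symplectic, OF _ _ _ _ skew that])
      (auto simp: symplectic_simps complex_eq_iff)
  have split: "\<exists>z1\<in>?S. \<exists>z2\<in>?U. z = z1 + z2" for z
    by (rule spectral_split) (rule no_imag)
  \<comment> \<open>In \<open>z = s + u\<close> the unstable part \<open>u\<close> is orthogonal to
    the stable space, because \<open>z\<close> and \<open>s\<close> are, and to the unstable space
    by isotropy. Nondegeneracy then forces \<open>u = 0\<close>.\<close>
  have maximal: "z \<in> ?S" if z: "\<And>x. x \<in> ?S \<Longrightarrow> symplectic x z = 0" for z
  proof -
    obtain s u where su: "s \<in> ?S" "u \<in> ?U" "z = s + u" using split by blast
    have "symplectic w u = 0" for w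
    proof -
      obtain w1 w2 where w: "w1 \<in> ?S" "w2 \<in> ?U" "w = w1 + w2" using split by blast
      have "symplectic w1 u = symplectic w1 z - symplectic w1 s"
        using su by (simp add: symplectic_simps)
      then show ?thesis using z[OF w(1)] iso_S[OF w(1) su(1)] iso_U[OF w(2) su(2)] w(3)
        by (simp add: symplectic_simps)
    qed
    then have "u = 0" by (rule symplectic_nondegenerate)
    with su show ?thesis by simp
  qed
  have inj: "z = 0" if z: "z \<in> ?S" "fst_block z = 0" for z
  proof (rule ccontr)
    assume "z \<noteq> 0"
    from z(1) obtain L where L: "\<forall>l\<in>set L. Re l < 0" "prod_shift H L z = 0"
      by (auto simp: spectral_space_def)
    \<comment> \<open>This intersection is invariant under \<open>H\<close>: isotropy applied to
      \<open>w\<close> and \<open>H w\<close> gives \<open>q\<^sup>* G q = 0\<close> for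
      \<open>q = snd_block w\<close>, hence \<open>G q = 0\<close>, which is the first component of
      \<open>H w\<close>. So it contains an eigenvector of \<open>H\<close> unless it is
      trivial.\<close>
    let ?K = "{w \<in> ?S. fst_block w = 0}"
    have G0: "complex_matrix G *v snd_block w = 0" if "w \<in> ?K" for w
    proof (rule complex_pos_semidef_mult_eq_0[OF G])
      have "symplectic w (H *v w) = 0"
        using that by (intro iso_S spectral_space_mult) auto
      then show "hermitian_dot (snd_block w) (complex_matrix G *v snd_block w) = 0"
        using that by (simp add: symplectic_def H_def block_mult hermitian_dot_simps)
    qed
    have "H *v w - l *s w \<in> ?K" if "w \<in> ?K" for l w
      using that G0[OF that] spectral_space_shift[of w "\<lambda>l. Re l < 0" H l]
      by (simp add: fst_block_simps H_def block_mult)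
    with ex_eigenvector_if_prod_shift_eq_0[OF L(2) \<open>z \<noteq> 0\<close>, of ?K] z
    obtain l v where v: "l \<in> set L" "v \<in> ?K" "v \<noteq> 0" "H *v v = l *s v" by blast
    have "snd_block (H *v v) = l *s snd_block v"
      by (simp only: v(4) snd_block_simps)
    \<comment> \<open>The lower right block of \<open>H\<close> is \<open>- transpose N\<close>, so
      a stable eigenvalue of \<open>H\<close> turns into one of \<open>transpose N\<close> with
      positive real part.\<close>
    then have "complex_matrix (transpose N) *v snd_block v = (- l) *s snd_block v"
      using v(2) by (simp add: H_def block_mult complex_matrix_uminus minus_equation_iff)
    moreover have "Re (- l) > 0" using v(1) L(1) by auto
    ultimately have "snd_block v = 0" using G0[OF v(2)] by (rule stab)
    with v(2,3) show False using block_eq_0[of v] by auto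
  qed
  let ?T = "fst_block ` ?S"
  have "subspace ?T"
  proof (rule subspaceI)
    show "0 \<in> ?T" using zero_spectral_space fst_block_simps(4) by (metis imageI)
    show "x + y \<in> ?T" if "x \<in> ?T" "y \<in> ?T" for x y
      using that spectral_space_add fst_block_simps(1) by (smt (verit) imageE imageI)
    show "c *\<^sub>R x \<in> ?T" if x: "x \<in> ?T" for c x
    proof -
      from x obtain z where z: "z \<in> ?S" "x = fst_block z" by auto
      have "c *\<^sub>R x = fst_block (complex_of_real c *s z)"
        by (simp add: z(2) fst_block_simps vec_eq_iff scaleR_conv_of_real[where 'a = complex])
      with spectral_space_scale[OF z(1)] show ?thesis by auto
    qed
  qed
  have "?T = UNIV"
  proof (rule ccontr)
    assume "?T \<noteq> UNIV"
    with \<open>subspace ?T\<close> have "span ?T \<subset> span UNIV" by (simp add: span_eq_iff[THEN iffD2] psubset_eq)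
    then obtain b where b: "b \<noteq> 0" "\<And>y. y \<in> span ?T \<Longrightarrow> orthogonal b y"
      using orthogonal_to_subspace_exists_gen[of ?T UNIV] by blast
    have "join_block 0 b \<in> ?S"
    proof (rule maximal)
      fix x assume x: "x \<in> ?S"
      have "Re (hermitian_dot (fst_block w) b) = 0" if "w \<in> ?S" for w
        using b(2)[of "fst_block w"] that
        by (simp add: Re_hermitian_dot orthogonal_def span_base inner_commute)
      \<comment> \<open>The vector \<open>b\<close> is orthogonal only for the real inner product.
        Using it on \<open>x\<close> and on \<open>\<i>\<close> times \<open>x\<close> gives the
        real and the imaginary part of the Hermitian product.\<close>
      from this[OF x] this[OF spectral_space_scale[OF x, of \<i>]]
      have "hermitian_dot (fst_block x) b = 0"
        by (simp add: complex_eq_iff fst_block_simps hermitian_dot_simps)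
      then show "symplectic x (join_block 0 b) = 0"
        by (simp add: symplectic_def fst_block_simps snd_block_simps hermitian_dot_simps)
    qed
    from inj[OF this] have "snd_block (join_block (0 :: complex^'n) b) = 0"
      by (simp add: fst_block_simps snd_block_simps(4))
    then show False using b(1) by (simp add: snd_block_simps(5))
  qed
  then show ?thesis by (metis UNIV_I imageE)
qed

section \<open>Decaying trajectories\<close>

lemma norm_scaleC: "norm (c *s (v :: complex^'n)) = cmod c * norm v"
  by (simp add: norm_vec_def norm_mult L2_set_right_distrib)

lemma bounded_bilinear_scaleC: "bounded_bilinear ((*s) :: complex \<Rightarrow> complex^'n \<Rightarrow> complex^'n)"
proof
  show "(r *\<^sub>R a) *s b = r *\<^sub>R (a *s b)" "a *s (r *\<^sub>R b) = r *\<^sub>R (a *s b)"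
    for r a and b :: "complex^'n"
    by (simp_all add: vec_eq_iff)
  show "\<exists>K. \<forall>a (b :: complex^'n). norm (a *s b) \<le> norm a * norm b * K"
    by (rule exI[of _ 1]) (simp add: norm_scaleC)
qed (simp_all add: vec.scale_left_distrib vec.scale_right_distrib)

lemma ex_primitive_atLeast:
  fixes f :: "real \<Rightarrow> 'a::banach"
  assumes "continuous_on {0..} f" "0 \<le> t"
  shows "((\<lambda>u. integral {0..u} f) has_vector_derivative f t) (at t within {0..})"
proof -
  have "((\<lambda>u. integral {0..u} f) has_vector_derivative f t) (at t within {0..t+1})"
    using assms by (intro integral_has_vector_derivative continuous_on_subset[OF assms(1)]) auto
  also have "at t within {0..t+1} = at t within {0..}"
    by (rule at_within_nhd[of _ "{..<t+1}"]) auto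
  finally show ?thesis .
qed

lemma has_vector_derivative_exp_times:
  "((\<lambda>t. exp (l * complex_of_real t)) has_vector_derivative l * exp (l * complex_of_real t)) (at t within S)"
proof -
  have "((\<lambda>t. exp (t *\<^sub>R l)) has_vector_derivative exp (t *\<^sub>R l) * l) (at t within S)"
    by (rule exp_scaleR_has_vector_derivative_right)
  then show ?thesis by (simp add: scaleR_conv_of_real mult.commute)
qed

text \<open>Variation of constants: the trajectory through \<open>z\<close> is obtained from that through
  \<open>H z - l z\<close>, which is annihilated by one factor less.\<close>

lemma ex_decaying_trajectory:
  fixes H :: "complex^'m^'m"
  assumes "prod_shift H L z = 0" "\<And>l. l \<in> set L \<Longrightarrow> Re l < - a"
  shows "\<exists>\<phi> c. \<phi> 0 = z \<and>
    (\<forall>t\<ge>0. (\<phi> has_vector_derivative H *v \<phi> t) (at t within {0..})) \<and>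
    (\<forall>t\<ge>0. norm (\<phi> t) \<le> c * exp (- a * t))"
  using assms
proof (induction L arbitrary: z)
  case Nil
  then show ?case by (intro exI[of _ "\<lambda>_. 0"] exI[of _ 0]) simp
next
  case (Cons l L)
  let ?w = "H *v z - l *s z"
  obtain \<psi> c where \<psi>0: "\<psi> 0 = ?w"
    and \<psi>': "\<And>t. t \<ge> 0 \<Longrightarrow> (\<psi> has_vector_derivative H *v \<psi> t) (at t within {0..})"
    and \<psi>b: "\<And>t. t \<ge> 0 \<Longrightarrow> norm (\<psi> t) \<le> c * exp (- a * t)"
    using Cons.IH[of ?w] Cons.prems by auto
  define E where "E = (\<lambda>t. exp ((- l) * complex_of_real t))"
  define E' where "E' = (\<lambda>t. exp (l * complex_of_real t))"
  have EE: "E' t * E t = 1" for t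
    by (simp add: E_def E'_def mult_exp_exp)
  have norm_E: "cmod (E t) = exp (- Re l * t)" "cmod (E' t) = exp (Re l * t)" for t
    by (simp_all add: E_def E'_def)
  have E: "(E has_vector_derivative (- l) * E t) (at t within S)" for t S
    unfolding E_def by (rule has_vector_derivative_exp_times)
  have E': "(E' has_vector_derivative l * E' t) (at t within S)" for t S
    unfolding E'_def by (rule has_vector_derivative_exp_times)
  \<comment> \<open>Here a line above introduces the integrating factor; \<open>f\<close> is the
    forcing term after multiplication by \<open>exp (- l t)\<close>, and its primitive
    \<open>g\<close> yields the solution of \<open>\<phi>' = l \<phi> + \<psi>\<close>.\<close>
  define f where "f = (\<lambda>t. E t *s \<psi> t)"
  have f': "(f has_vector_derivative (E t *s (H *v \<psi> t) + ((- l) * E t) *s \<psi> t)) (at t within {0..})"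
    if "t \<ge> 0" for t
    unfolding f_def
    by (rule bounded_bilinear.has_vector_derivative[OF bounded_bilinear_scaleC E \<psi>'[OF that]])
  have contf: "continuous_on {0..} f"
    using f' has_vector_derivative_continuous by (force simp: continuous_on_eq_continuous_within)
  define g where "g = (\<lambda>t. z + integral {0..t} f)"
  have g': "(g has_vector_derivative f t) (at t within {0..})" if "t \<ge> 0" for t
    unfolding g_def using has_vector_derivative_add[OF has_vector_derivative_const ex_primitive_atLeast[OF contf that]]
    by simp
  have lin: "bounded_linear (\<lambda>v. H *v v - l *s v)"
    by (intro bounded_linear_sub matrix_vector_mul_bounded_linear
        bounded_bilinear.bounded_linear_right[OF bounded_bilinear_scaleC])
  \<comment> \<open>This defect has zero derivative and vanishes at 0. Hence
    \<open>H \<phi> - l \<phi> = \<psi>\<close> at all times, which turns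
    \<open>\<phi>' = l \<phi> + \<psi>\<close> into \<open>\<phi>' = H \<phi>\<close>.\<close>
  let ?d = "\<lambda>t. (H *v g t - l *s g t) - f t"
  have "(?d has_vector_derivative 0) (at t within {0..})" if "t \<in> {0..}" for t
  proof -
    have "(?d has_vector_derivative (H *v f t - l *s f t) - (E t *s (H *v \<psi> t) + ((- l) * E t) *s \<psi> t)) (at t within {0..})"
      using that by (intro has_vector_derivative_diff bounded_linear.has_vector_derivative[OF lin] g' f') auto
    then show ?thesis
      by (simp add: f_def vector_scalar_commute vector_smult_assoc)
  qed
  then obtain k where k: "\<And>t. t \<in> {0..} \<Longrightarrow> ?d t = k"
    using has_vector_derivative_zero_constant[of "{0..}" ?d] by (auto simp: convex_real_interval)
  have "?d 0 = 0" by (simp add: g_def f_def \<psi>0 E_def)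
  with k[of 0] have d0: "H *v g t = l *s g t + f t" if "t \<ge> 0" for t
    using k[of t] that by (simp add: algebra_simps)
  define \<phi> where "\<phi> = (\<lambda>t. E' t *s g t)"
  have "(\<phi> has_vector_derivative H *v \<phi> t) (at t within {0..})" if "t \<ge> 0" for t
  proof -
    have "(\<phi> has_vector_derivative E' t *s f t + (l * E' t) *s g t) (at t within {0..})"
      unfolding \<phi>_def
      by (rule bounded_bilinear.has_vector_derivative[OF bounded_bilinear_scaleC E' g'[OF that]])
    moreover have "H *v \<phi> t = E' t *s f t + (l * E' t) *s g t"
      unfolding \<phi>_def vector_scalar_commute d0[OF that]
      by (simp add: vec.scale_right_distrib vector_smult_assoc mult.commute)
    ultimately show ?thesis by simp
  qed
  moreover have "\<phi> 0 = z" by (simp add: \<phi>_def g_def E'_def)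
  moreover have "norm (\<phi> t) \<le> (norm z + c / (- Re l - a)) * exp (- a * t)" if t: "t \<ge> 0" for t
  proof -
    \<comment> \<open>The gap between the decay rate of this factor and the target rate
      \<open>a\<close>. Its strict positivity bounds the convolution by
      \<open>c / k * exp (- a * t)\<close>, so repeated entries cost no polynomial factor.\<close>
    define k where "k = - Re l - a"
    have k: "k > 0" using Cons.prems(2)[of l] by (simp add: k_def)
    have c: "c \<ge> 0" using \<psi>b[of 0] norm_ge_zero[of "\<psi> 0"] by (simp del: norm_ge_zero)
    have "((\<lambda>s. c * exp (k * s)) has_integral (c / k * exp (k * t) - c / k * exp (k * 0))) {0..t}"
      using t k
      by (intro fundamental_theorem_of_calculus)
        (auto intro!: derivative_eq_intros simp flip: has_real_derivative_iff_has_vector_derivative)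
    note this[THEN has_integral_integrable] this[THEN integral_unique]
    then have i: "(\<lambda>s. c * exp (k * s)) integrable_on {0..t}"
        "integral {0..t} (\<lambda>s. c * exp (k * s)) = c / k * exp (k * t) - c / k"
      by (simp_all only: mult_zero_right exp_zero mult_1_right)
    have "norm (integral {0..t} f) \<le> integral {0..t} (\<lambda>s. c * exp (k * s))"
    proof (rule integral_norm_bound_integral)
      show "f integrable_on {0..t}"
        by (intro integrable_continuous_real continuous_on_subset[OF contf]) auto
      show "norm (f s) \<le> c * exp (k * s)" if "s \<in> {0..t}" for s
      proof -
        have "norm (f s) = exp (- Re l * s) * norm (\<psi> s)"
          by (simp only: f_def norm_scaleC norm_E)
        also have "\<dots> \<le> exp (- Re l * s) * (c * exp (- a * s))"
          using \<psi>b[of s] that by (intro mult_left_mono) auto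
        also have "\<dots> = c * exp (k * s)"
          by (simp add: k_def mult_exp_exp algebra_simps)
        finally show ?thesis .
      qed
    qed (rule i)
    also have "\<dots> \<le> c / k * exp (k * t)" unfolding i(2) using c k by simp
    finally have "norm (g t) \<le> norm z + c / k * exp (k * t)"
      unfolding g_def by (rule norm_triangle_le[OF add_left_mono])
    then have "norm (\<phi> t) \<le> exp (Re l * t) * (norm z + c / k * exp (k * t))"
      unfolding \<phi>_def norm_scaleC norm_E by (intro mult_left_mono) auto
    also have "\<dots> = norm z * exp (Re l * t) + c / k * exp (- a * t)"
      by (simp add: k_def mult_exp_exp algebra_simps)
    also have "\<dots> \<le> norm z * exp (- a * t) + c / k * exp (- a * t)"
      using mult_right_mono[of "Re l" "- a" t] t Cons.prems(2)[of l]
      by (intro add_right_mono mult_left_mono) auto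
    finally show ?thesis by (simp add: k_def distrib_right)
  qed
  ultimately show ?case by blast
qed

lemma spectral_space_decaying_trajectory:
  fixes H :: "complex^'m^'m"
  assumes "z \<in> spectral_space (\<lambda>l. Re l < 0) H"
  shows "\<exists>\<phi> c a. a > 0 \<and> \<phi> 0 = z \<and>
    (\<forall>t\<ge>0. (\<phi> has_vector_derivative H *v \<phi> t) (at t within {0..})) \<and>
    (\<forall>t\<ge>0. norm (\<phi> t) \<le> c * exp (- a * t))"
proof -
  obtain L where L: "\<forall>l\<in>set L. Re l < 0" "prod_shift H L z = 0"
    using assms by (auto simp: spectral_space_def)
  \<comment> \<open>Inserting -1 covers the empty list. The decay rate is half the distance of the
    listed values from the axis, to make the inequality strict.\<close>
  define m where "m = Max (insert (- 1) (Re ` set L))"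
  have m: "m < 0" using L(1) by (simp add: m_def)
  have "Re l < - (- m / 2)" if "l \<in> set L" for l
  proof -
    have "Re l \<le> m" using that by (simp add: m_def)
    then show ?thesis using m by linarith
  qed
  from ex_decaying_trajectory[OF L(2) this] m show ?thesis
    by (metis half_gt_zero neg_0_less_iff_less)
qed

text \<open>The block matrix is real, so the real part of a complex trajectory is again a
  trajectory; it decays at the same rate and starts at the real vector \<open>u\<close>.\<close>

lemma ex_decaying_hamiltonian_trajectory:
  fixes N G Q :: "real^'n^'n"
  assumes G: "pos_semidef G" and Q: "transpose Q = Q"
    and no_imag: "\<And>l. complex_eigenvalue (block_matrix N G (- Q) (- transpose N)) l \<Longrightarrow> Re l \<noteq> 0"
    and stab: "\<And>l v. complex_matrix (transpose N) *v v = l *s v \<Longrightarrow> Re l > 0 \<Longrightarrow>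
      complex_matrix G *v v = 0 \<Longrightarrow> v = 0"
  shows "\<exists>y q c a. a > 0 \<and> y 0 = u \<and>
    (\<forall>t\<ge>0. (y has_vector_derivative N *v y t + G *v q t) (at t within {0..})) \<and>
    (\<forall>t\<ge>0. (q has_vector_derivative - (Q *v y t) - transpose N *v q t) (at t within {0..})) \<and>
    (\<forall>t\<ge>0. norm (y t) \<le> c * exp (- a * t) \<and> norm (q t) \<le> c * exp (- a * t))"
proof -
  let ?H = "complex_matrix (block_matrix N G (- Q) (- transpose N))"
  have ni: "Re l \<noteq> 0" if "v \<noteq> 0" "?H *v v = l *s v" for l v
    using no_imag[of l] that unfolding complex_eigenvalue_def by blast
  have "\<exists>z\<in>spectral_space (\<lambda>l. Re l < 0) ?H. fst_block z = (\<chi> i. complex_of_real (u $ i))"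
    by (rule spectral_space_fst_block_surj[OF G Q]) (fact ni stab)+
  then obtain z where z: "z \<in> spectral_space (\<lambda>l. Re l < 0) ?H"
      "fst_block z = (\<chi> i. complex_of_real (u $ i))"
    by blast
  obtain \<phi> c a where a: "a > 0" and \<phi>0: "\<phi> 0 = z"
    and \<phi>': "\<And>t. t \<ge> 0 \<Longrightarrow> (\<phi> has_vector_derivative ?H *v \<phi> t) (at t within {0..})"
    and \<phi>b: "\<And>t. t \<ge> 0 \<Longrightarrow> norm (\<phi> t) \<le> c * exp (- a * t)"
    using spectral_space_decaying_trajectory[OF z(1)] by blast
  let ?f = "\<lambda>z. Re_vec (fst_block z :: complex^'n)" and ?s = "\<lambda>z. Re_vec (snd_block z :: complex^'n)"
  have lin: "bounded_linear ?f" "bounded_linear ?s"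
    unfolding linear_conv_bounded_linear[symmetric]
    by (auto intro!: linearI simp: Re_vec_def fst_block_def snd_block_def vec_eq_iff)
  have norm_le: "norm (?f z) \<le> norm z" "norm (?s z) \<le> norm z" for z :: "complex^('n + 'n)"
  proof -
    have "(norm z)\<^sup>2 = (\<Sum>i\<in>UNIV. (cmod (z $ Inl i))\<^sup>2) + (\<Sum>i\<in>UNIV. (cmod (z $ Inr i))\<^sup>2)"
      by (simp add: norm_vec_def L2_set_def sum_UNIV_sum sum_nonneg add_nonneg_nonneg)
    moreover have "(norm (?f z))\<^sup>2 \<le> (\<Sum>i\<in>UNIV. (cmod (z $ Inl i))\<^sup>2)"
        "(norm (?s z))\<^sup>2 \<le> (\<Sum>i\<in>UNIV. (cmod (z $ Inr i))\<^sup>2)"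
      by (simp_all add: norm_vec_def L2_set_def sum_nonneg Re_vec_def fst_block_def snd_block_def
          cmod_power2 sum_mono)
    moreover have "(\<Sum>i\<in>UNIV. (cmod (z $ Inl i))\<^sup>2) \<ge> 0" "(\<Sum>i\<in>UNIV. (cmod (z $ Inr i))\<^sup>2) \<ge> 0"
      by (simp_all add: sum_nonneg)
    ultimately have "(norm (?f z))\<^sup>2 \<le> (norm z)\<^sup>2" "(norm (?s z))\<^sup>2 \<le> (norm z)\<^sup>2"
      by linarith+
    then show "norm (?f z) \<le> norm z" "norm (?s z) \<le> norm z"
      by (simp_all add: power2_le_iff_abs_le)
  qed
  have Re_vec_simps: "Re_vec (v + w) = Re_vec v + Re_vec w" "Re_vec (v - w) = Re_vec v - Re_vec w"
      "Re_vec (- v) = - Re_vec v" for v w :: "complex^'n"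
    by (simp_all add: Re_vec_def vec_eq_iff)
  show ?thesis
  proof (intro exI conjI allI impI)
    show "a > 0" by (rule a)
    show "?f (\<phi> 0) = u" by (simp add: \<phi>0 z(2) Re_vec_def)
    fix t :: real assume t: "t \<ge> 0"
    show "((\<lambda>t. ?f (\<phi> t)) has_vector_derivative N *v ?f (\<phi> t) + G *v ?s (\<phi> t)) (at t within {0..})"
      using bounded_linear.has_vector_derivative[OF lin(1) \<phi>'[OF t]]
      by (simp add: block_mult Re_vec_simps Re_vec_mult)
    show "((\<lambda>t. ?s (\<phi> t)) has_vector_derivative - (Q *v ?f (\<phi> t)) - transpose N *v ?s (\<phi> t)) (at t within {0..})"
      using bounded_linear.has_vector_derivative[OF lin(2) \<phi>'[OF t]]
      by (simp add: block_mult complex_matrix_uminus Re_vec_simps Re_vec_mult del: transpose_matrix_vector)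
    show "norm (?f (\<phi> t)) \<le> c * exp (- a * t)" "norm (?s (\<phi> t)) \<le> c * exp (- a * t)"
      using norm_le[of "\<phi> t"] \<phi>b[OF t] by linarith+
  qed
qed

section \<open>Well-posedness of the deterministic system\<close>

text \<open>An energy form of Gronwall: with \<open>K\<close> a bound for \<open>L\<close>, the
  quantity \<open>exp (- 2 K t) |z|\<^sup>2\<close> is nonincreasing and starts at 0.\<close>

lemma linear_ode_eq_0:
  fixes z :: "real \<Rightarrow> 'a::real_inner"
  assumes "bounded_linear L" and 0: "z 0 = 0"
    and z': "\<And>t. t \<ge> 0 \<Longrightarrow> (z has_vector_derivative L (z t)) (at t within {0..})"
    and t: "t \<ge> 0"
  shows "z t = 0"
proof (cases "t = 0")
  case False
  obtain K where K: "\<And>v. norm (L v) \<le> norm v * K" using bounded_linear.bounded[OF assms(1)] by blast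
  define g where "g = (\<lambda>t. exp (- 2 * K * t) * (z t \<bullet> z t))"
  have g': "(g has_real_derivative exp (- 2 * K * t) * (2 * (z t \<bullet> L (z t)) - 2 * K * (z t \<bullet> z t))) (at t within {0..})"
    if "t \<ge> 0" for t
    unfolding g_def using z'[OF that, unfolded has_vector_derivative_def]
    by (auto intro!: derivative_eq_intros simp: has_field_derivative_def inner_commute algebra_simps fun_eq_iff)
  have "g t \<le> g 0"
  proof (rule DERIV_nonpos_imp_decreasing_open[where f = g and a = 0 and b = t])
    show "continuous_on {0..t} g"
      by (rule continuous_on_subset[of "{0..}"]) (auto intro!: DERIV_continuous_on g')
    show "\<exists>y. DERIV g x :> y \<and> y \<le> 0" if x: "0 < x" "x < t" for x
    proof (intro exI conjI)
      show "DERIV g x :> exp (- 2 * K * x) * (2 * (z x \<bullet> L (z x)) - 2 * K * (z x \<bullet> z x))"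
        using g'[of x] x at_within_interior[of x "{0..}"] by simp
      have "z x \<bullet> L (z x) \<le> norm (z x) * norm (L (z x))" by (rule norm_cauchy_schwarz)
      also have "\<dots> \<le> norm (z x) * (norm (z x) * K)" by (intro mult_left_mono K) simp
      finally have "z x \<bullet> L (z x) \<le> K * (z x \<bullet> z x)"
        by (simp add: dot_square_norm power2_eq_square mult_ac)
      then show "exp (- 2 * K * x) * (2 * (z x \<bullet> L (z x)) - 2 * K * (z x \<bullet> z x)) \<le> 0"
        by (simp add: mult_le_0_iff)
    qed
  qed (use t False in auto)
  then have "z t \<bullet> z t \<le> 0" by (simp add: g_def 0 mult_le_0_iff)
  then have "z t \<bullet> z t = 0" by (intro antisym inner_ge_zero)
  then show ?thesis by (simp only: inner_eq_zero_iff)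
qed (simp add: 0)

lemma emeasure_lborel_atLeast: "emeasure lborel {0::real..} = \<infinity>"
proof -
  have "ennreal (real n) \<le> emeasure lborel {0::real..}" for n
    using emeasure_mono[of "{0..real n}" "{0..}" lborel] by simp
  then show ?thesis
    by (metis ennreal_of_nat_eq_real_of_nat infinity_ennreal_def linorder_not_less
        of_nat_less_top ennreal_Ex_less_of_nat top.not_eq_extremum)
qed

lemma set_integrable_const_atLeast_eq_0:
  fixes c :: real
  assumes "set_integrable lborel {0..} (\<lambda>t::real. c)"
  shows "c = 0"
proof (rule ccontr)
  assume "c \<noteq> 0"
  then have "integrable lborel (indicator {0..} :: real \<Rightarrow> real)"
    using assms by (simp add: set_integrable_def)
  then show False by (simp add: integrable_indicator_iff emeasure_lborel_atLeast)
qed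

lemma set_integrable_exp_atLeast:
  assumes "a > (0::real)"
  shows "set_integrable lborel {0..} (\<lambda>t. c * exp (- a * t))"
proof -
  have "(\<integral>\<^sup>+t. ennreal (exp (- a * t)) * indicator {0..} t \<partial>lborel) = 0 - (- exp (- a * 0) / a)"
  proof (rule nn_integral_FTC_atLeast)
    show "((\<lambda>t. - exp (- a * t) / a) \<longlongrightarrow> 0) at_top"
      using assms by real_asymp
  qed (use assms in \<open>auto intro!: derivative_eq_intros\<close>)
  then have "(\<integral>\<^sup>+t. ennreal (indicator {0..} t * exp (- a * t)) \<partial>lborel) < \<infinity>"
    by (simp add: mult.commute ennreal_indicator ennreal_mult' )
  then have "set_integrable lborel {0..} (\<lambda>t. exp (- a * t))"
    unfolding set_integrable_def by (intro integrableI_bounded) auto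
  then show ?thesis by simp
qed

text \<open>Reduces uniqueness to zero initial state. Membership in the weighted space rests on
  \<open>|u - v|\<^sup>2 \<le> 2 (|u|\<^sup>2 + |v|\<^sup>2)\<close>.\<close>

lemma mean_field_solution_diff:
  assumes 1: "mean_field_solution \<rho> Abar G Q x0 s x" and 2: "mean_field_solution \<rho> Abar G Q x1 s' x'"
  shows "mean_field_solution \<rho> Abar G Q (x0 - x1) (\<lambda>t. s t - s' t) (\<lambda>t. x t - x' t)"
  unfolding mean_field_solution_def
proof (intro conjI allI impI)
  let ?f = "\<lambda>t. (s t, x t)" and ?g = "\<lambda>t. (s' t, x' t)"
  have f: "continuous_on {0..} ?f" "set_integrable lborel {0..} (\<lambda>t. exp (- \<rho> * t) * (norm (?f t))\<^sup>2)"
    and g: "continuous_on {0..} ?g" "set_integrable lborel {0..} (\<lambda>t. exp (- \<rho> * t) * (norm (?g t))\<^sup>2)"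
    using 1 2 by (auto simp: mean_field_solution_def C_half_def)
  have "set_integrable lborel {0..} (\<lambda>t. exp (- \<rho> * t) * (norm (?f t - ?g t))\<^sup>2)"
  proof (rule set_integrable_bound)
    show "set_integrable lborel {0..} (\<lambda>t. 2 * (exp (- \<rho> * t) * (norm (?f t))\<^sup>2 + exp (- \<rho> * t) * (norm (?g t))\<^sup>2))"
      by (intro set_integrable_mult_right set_integral_add f g)
    show "set_borel_measurable lborel {0..} (\<lambda>t. exp (- \<rho> * t) * (norm (?f t - ?g t))\<^sup>2)"
      unfolding set_borel_measurable_def measurable_lborel2
      by (intro borel_measurable_continuous_on_indicator continuous_intros f g) auto
    have "norm (exp (- \<rho> * t) * (norm (u - v))\<^sup>2)
        \<le> norm (2 * (exp (- \<rho> * t) * (norm u)\<^sup>2 + exp (- \<rho> * t) * (norm v)\<^sup>2))"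
      for t and u v :: "(real^'a) \<times> (real^'a)"
    proof -
      have "(norm (u - v))\<^sup>2 \<le> (norm u + norm v)\<^sup>2"
        by (intro power_mono norm_triangle_ineq4) simp
      also have "\<dots> \<le> 2 * ((norm u)\<^sup>2 + (norm v)\<^sup>2)"
        using sum_squares_bound[of "norm u" "norm v"] by (simp add: power2_sum)
      finally have "exp (- \<rho> * t) * (norm (u - v))\<^sup>2 \<le> exp (- \<rho> * t) * (2 * ((norm u)\<^sup>2 + (norm v)\<^sup>2))"
        by (intro mult_left_mono) auto
      also have "\<dots> = 2 * (exp (- \<rho> * t) * (norm u)\<^sup>2 + exp (- \<rho> * t) * (norm v)\<^sup>2)"
        by (simp add: algebra_simps)
      finally have le: "exp (- \<rho> * t) * (norm (u - v))\<^sup>2 \<le> \<dots>" .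
      have nonneg: "0 \<le> exp (- \<rho> * t) * (norm (u - v))\<^sup>2" by simp
      show ?thesis unfolding real_norm_def abs_of_nonneg[OF nonneg] using le by linarith
    qed
    then show "AE t in lborel. t \<in> {0..} \<longrightarrow> norm (exp (- \<rho> * t) * (norm (?f t - ?g t))\<^sup>2)
        \<le> norm (2 * (exp (- \<rho> * t) * (norm (?f t))\<^sup>2 + exp (- \<rho> * t) * (norm (?g t))\<^sup>2))"
      by (intro AE_I2 impI)
  qed
  with continuous_on_diff[OF f(1) g(1)] show "(\<lambda>t. (s t - s' t, x t - x' t)) \<in> C_half \<rho>"
    by (simp add: C_half_def)
  show "x 0 - x' 0 = x0 - x1" using 1 2 by (simp add: mean_field_solution_def)
  fix t :: real assume "0 \<le> t"
  then obtain d d' where d: "(s has_vector_derivative d) (at t within {0..})"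
      "\<rho> *\<^sub>R s t = d + transpose Abar *v s t - Q *v x t"
      "(s' has_vector_derivative d') (at t within {0..})"
      "\<rho> *\<^sub>R s' t = d' + transpose Abar *v s' t - Q *v x' t"
    using 1 2 unfolding mean_field_solution_def by blast
  have "\<rho> *\<^sub>R (s t - s' t) = (d - d') + transpose Abar *v (s t - s' t) - Q *v (x t - x' t)"
    using d(2,4) by (simp add: scaleR_right_diff_distrib matrix_vector_mult_diff_distrib
        del: transpose_matrix_vector)
  then show "\<exists>ds. ((\<lambda>t. s t - s' t) has_vector_derivative ds) (at t within {0..}) \<and>
      \<rho> *\<^sub>R (s t - s' t) = ds + transpose Abar *v (s t - s' t) - Q *v (x t - x' t)"
    using has_vector_derivative_diff[OF d(1,3)] by blast
  have "((\<lambda>t. x t - x' t) has_vector_derivative ((Abar *v x t - G *v s t) - (Abar *v x' t - G *v s' t)))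
      (at t within {0..})"
    by (rule has_vector_derivative_diff) (use 1 2 \<open>0 \<le> t\<close> in \<open>auto simp only: mean_field_solution_def\<close>)
  then show "((\<lambda>t. x t - x' t) has_vector_derivative (Abar *v (x t - x' t) - G *v (s t - s' t))) (at t within {0..})"
    by (simp add: matrix_vector_mult_diff_distrib algebra_simps)
qed

lemma mean_field_solution_costate_deriv:
  assumes "mean_field_solution \<rho> Abar G Q x0 s x" "t \<ge> 0"
  shows "(s has_vector_derivative \<rho> *\<^sub>R s t - transpose Abar *v s t + Q *v x t) (at t within {0..})"
proof -
  obtain d where "(s has_vector_derivative d) (at t within {0..})"
      "\<rho> *\<^sub>R s t = d + transpose Abar *v s t - Q *v x t"
    using assms unfolding mean_field_solution_def by blast
  then show ?thesis by (simp del: transpose_matrix_vector)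
qed

text \<open>The discounted symplectic product with a solution starting at \<open>s 0\<close> is constant, equal to
  \<open>|s 0|\<^sup>2\<close>, and integrable, so \<open>s 0 = 0\<close>.\<close>

lemma mean_field_solution_unique:
  fixes Abar G Q :: "real^'n^'n"
  assumes sym: "transpose G = G" "transpose Q = Q"
    and ex: "\<And>x0. \<exists>s x. mean_field_solution \<rho> Abar G Q x0 s x"
    and sol: "mean_field_solution \<rho> Abar G Q 0 s x" and t: "t \<ge> 0"
  shows "s t = 0 \<and> x t = 0"
proof -
  obtain S X where SX: "mean_field_solution \<rho> Abar G Q (s 0) S X" using ex by blast
  note s' = mean_field_solution_costate_deriv[OF sol]
  note S' = mean_field_solution_costate_deriv[OF SX]
  have x': "(x has_vector_derivative (Abar *v x t - G *v s t)) (at t within {0..})"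
    and X': "(X has_vector_derivative (Abar *v X t - G *v S t)) (at t within {0..})" if "t \<ge> 0" for t
    using sol SX that by (simp_all add: mean_field_solution_def)
  have adj: "u \<bullet> (transpose M *v v) = (M *v u) \<bullet> v" for u v and M :: "real^'n^'n"
    by (metis dot_lmul_matrix transpose_matrix_vector transpose_transpose)
  define h where "h = (\<lambda>t. exp (- \<rho> * t) * (X t \<bullet> s t - S t \<bullet> x t))"
  have h': "(h has_vector_derivative 0) (at t within {0..})" if t: "t \<ge> 0" for t
  proof -
    let ?D = "X t \<bullet> (\<rho> *\<^sub>R s t - transpose Abar *v s t + Q *v x t) + (Abar *v X t - G *v S t) \<bullet> s t
       - (S t \<bullet> (Abar *v x t - G *v s t) + (\<rho> *\<^sub>R S t - transpose Abar *v S t + Q *v X t) \<bullet> x t)"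
    have e: "((\<lambda>t. exp (- \<rho> * t)) has_vector_derivative - \<rho> * exp (- \<rho> * t)) (at t within {0..})"
      by (auto intro!: derivative_eq_intros simp flip: has_real_derivative_iff_has_vector_derivative)
    have "(h has_vector_derivative exp (- \<rho> * t) * ?D + (- \<rho> * exp (- \<rho> * t)) * (X t \<bullet> s t - S t \<bullet> x t))
        (at t within {0..})"
      unfolding h_def
      by (intro bounded_bilinear.has_vector_derivative[OF bounded_bilinear_mult] e has_vector_derivative_diff
          bounded_bilinear.has_vector_derivative[OF bounded_bilinear_inner] x' X' s' S' t)
    \<comment> \<open>The terms with \<open>Abar\<close> cancel by adjointness, those with
      \<open>G\<close> and \<open>Q\<close> by symmetry. What remains is the growth
      \<open>\<rho>\<close>, offset by the derivative of the discount.\<close>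
    moreover have "?D = \<rho> * (X t \<bullet> s t - S t \<bullet> x t)"
      using adj[of "X t" Q "x t"] adj[of "S t" G "s t"] sym adj[of "x t" Abar "S t"]
      by (simp add: inner_diff inner_add inner_add_right inner_diff_right adj inner_commute[of "transpose Abar *v S t"]
          inner_commute[of "Abar *v x t" "S t"] algebra_simps
          del: transpose_matrix_vector)
    ultimately have "(h has_vector_derivative exp (- \<rho> * t) * (\<rho> * (X t \<bullet> s t - S t \<bullet> x t))
        + (- \<rho> * exp (- \<rho> * t)) * (X t \<bullet> s t - S t \<bullet> x t)) (at t within {0..})"
      by (simp only:)
    then show ?thesis by simp
  qed
  then obtain k where k: "\<And>t. t \<in> {0..} \<Longrightarrow> h t = k"
    using has_vector_derivative_zero_constant[of "{0..}" h] by (auto simp: convex_real_interval)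
  have "h 0 = s 0 \<bullet> s 0" using sol SX by (simp add: h_def mean_field_solution_def)
  with k[of 0] have hk: "h t = s 0 \<bullet> s 0" if "t \<ge> 0" for t using k[of t] that by simp
  have C: "set_integrable lborel {0..} (\<lambda>t. exp (- \<rho> * t) * (norm (s t, x t))\<^sup>2)"
      "set_integrable lborel {0..} (\<lambda>t. exp (- \<rho> * t) * (norm (S t, X t))\<^sup>2)"
    using sol SX by (auto simp: mean_field_solution_def C_half_def)
  have "set_integrable lborel {0..} (\<lambda>t::real. s 0 \<bullet> s 0)"
  proof (rule set_integrable_bound)
    show "set_integrable lborel {0..} (\<lambda>t. exp (- \<rho> * t) * (norm (s t, x t))\<^sup>2 + exp (- \<rho> * t) * (norm (S t, X t))\<^sup>2)"
      by (intro set_integral_add C)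
    have "norm (s 0 \<bullet> s 0) \<le> norm (exp (- \<rho> * t) * (norm (s t, x t))\<^sup>2 + exp (- \<rho> * t) * (norm (S t, X t))\<^sup>2)"
      if "t \<ge> 0" for t
    proof -
      have "norm (s 0 \<bullet> s 0) = exp (- \<rho> * t) * \<bar>X t \<bullet> s t - S t \<bullet> x t\<bar>"
        unfolding hk[OF that, symmetric] by (simp add: h_def abs_mult)
      also have "\<bar>X t \<bullet> s t - S t \<bullet> x t\<bar> \<le> norm (X t) * norm (s t) + norm (S t) * norm (x t)"
        using Cauchy_Schwarz_ineq2[of "X t" "s t"] Cauchy_Schwarz_ineq2[of "S t" "x t"] by linarith
      also have "\<dots> \<le> (norm (s t, x t))\<^sup>2 + (norm (S t, X t))\<^sup>2"
        using sum_squares_bound[of "norm (X t)" "norm (s t)"] sum_squares_bound[of "norm (S t)" "norm (x t)"]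
          mult_nonneg_nonneg[of "norm (X t)" "norm (s t)"] mult_nonneg_nonneg[of "norm (S t)" "norm (x t)"]
        unfolding norm_Pair by (simp add: algebra_simps del: mult_nonneg_nonneg)
      finally show ?thesis by (simp add: distrib_left mult_left_mono)
    qed
    then show "AE t in lborel. t \<in> {0..} \<longrightarrow> norm (s 0 \<bullet> s 0)
        \<le> norm (exp (- \<rho> * t) * (norm (s t, x t))\<^sup>2 + exp (- \<rho> * t) * (norm (S t, X t))\<^sup>2)"
      by simp
  qed (simp add: set_borel_measurable_def)
  then have "s 0 \<bullet> s 0 = 0" by (rule set_integrable_const_atLeast_eq_0)
  \<comment> \<open>The missing initial value of \<open>s\<close> is now known, so uniqueness for
    the ordinary initial value problem applies.\<close>
  then have "(s 0, x 0) = 0" using sol by (simp add: mean_field_solution_def zero_prod_def)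
  moreover have "bounded_linear (\<lambda>(u, v). (\<rho> *\<^sub>R u - transpose Abar *v u + Q *v v, Abar *v v - G *v u))"
    unfolding linear_conv_bounded_linear[symmetric]
    by (rule linearI)
      (auto simp: algebra_simps matrix_vector_right_distrib matrix_vector_mult_scaleR simp del: transpose_matrix_vector)
  moreover have "((\<lambda>t. (s t, x t)) has_vector_derivative
      (case (s t, x t) of (u, v) \<Rightarrow> (\<rho> *\<^sub>R u - transpose Abar *v u + Q *v v, Abar *v v - G *v u)))
      (at t within {0..})" if "t \<ge> 0" for t
    unfolding prod.case by (intro has_vector_derivative_Pair s' x' that)
  ultimately have "(s t, x t) = 0"
    using linear_ode_eq_0[of _ "\<lambda>t. (s t, x t)" t] t by blast
  then show ?thesis by (simp add: zero_prod_def)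
qed

text \<open>Multiplying the decaying trajectory by \<open>exp (\<rho> / 2 * t)\<close> removes the
  shift in \<open>N\<close>. The weight \<open>exp (- \<rho> * t)\<close> exactly cancels the square
  of this factor, leaving an integrand of order \<open>exp (- 2 a t)\<close>.\<close>

lemma mean_field_solution_exists:
  fixes Abar G Q :: "real^'n^'n" and \<rho> :: real
  defines "N \<equiv> Abar - (\<rho> / 2) *\<^sub>R mat 1"
  assumes G: "pos_semidef G" and Q: "transpose Q = Q"
    and no_imag: "\<And>l. complex_eigenvalue (block_matrix N G (- Q) (- transpose N)) l \<Longrightarrow> Re l \<noteq> 0"
    and stab: "\<And>l v. complex_matrix (transpose N) *v v = l *s v \<Longrightarrow> Re l > 0 \<Longrightarrow>
      complex_matrix G *v v = 0 \<Longrightarrow> v = 0"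
  shows "\<exists>s x. mean_field_solution \<rho> Abar G Q x0 s x"
proof -
  have "\<exists>y q c a. a > 0 \<and> y 0 = x0 \<and>
      (\<forall>t\<ge>0. (y has_vector_derivative N *v y t + G *v q t) (at t within {0..})) \<and>
      (\<forall>t\<ge>0. (q has_vector_derivative - (Q *v y t) - transpose N *v q t) (at t within {0..})) \<and>
      (\<forall>t\<ge>0. norm (y t) \<le> c * exp (- a * t) \<and> norm (q t) \<le> c * exp (- a * t))"
    by (rule ex_decaying_hamiltonian_trajectory[OF G Q]) (fact no_imag stab)+
  then obtain y q c a where a: "a > 0" and y0: "y 0 = x0"
    and y': "\<And>t. t \<ge> 0 \<Longrightarrow> (y has_vector_derivative N *v y t + G *v q t) (at t within {0..})"
    and q': "\<And>t. t \<ge> 0 \<Longrightarrow> (q has_vector_derivative - (Q *v y t) - transpose N *v q t) (at t within {0..})"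
    and b: "\<And>t. t \<ge> 0 \<Longrightarrow> norm (y t) \<le> c * exp (- a * t)" "\<And>t. t \<ge> 0 \<Longrightarrow> norm (q t) \<le> c * exp (- a * t)"
    by blast
  define E where "E = (\<lambda>t::real. exp (\<rho> / 2 * t))"
  have E': "(E has_vector_derivative \<rho> / 2 * E t) (at t within {0..})" for t
    unfolding E_def
    by (auto intro!: derivative_eq_intros simp flip: has_real_derivative_iff_has_vector_derivative)
  define x where "x = (\<lambda>t. E t *\<^sub>R y t)"
  define s where "s = (\<lambda>t. - (E t *\<^sub>R q t))"
  have N: "N *v v = Abar *v v - (\<rho> / 2) *\<^sub>R v" "transpose N *v v = transpose Abar *v v - (\<rho> / 2) *\<^sub>R v" for v
  proof -
    have "transpose N = transpose Abar - (\<rho> / 2) *\<^sub>R mat 1"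
      by (simp add: N_def transpose_def mat_def vec_eq_iff)
    then show "N *v v = Abar *v v - (\<rho> / 2) *\<^sub>R v" "transpose N *v v = transpose Abar *v v - (\<rho> / 2) *\<^sub>R v"
      by (simp_all add: N_def matrix_vector_mult_diff_rdistrib scaleR_matrix_vector_assoc[symmetric]
          del: transpose_matrix_vector)
  qed
  have x': "(x has_vector_derivative (Abar *v x t - G *v s t)) (at t within {0..})" if "t \<ge> 0" for t
  proof -
    have "(x has_vector_derivative E t *\<^sub>R (N *v y t + G *v q t) + (\<rho> / 2 * E t) *\<^sub>R y t) (at t within {0..})"
      unfolding x_def
      by (rule bounded_bilinear.has_vector_derivative[OF bounded_bilinear_scaleR E' y'[OF that]])
    also have "E t *\<^sub>R (N *v y t + G *v q t) + (\<rho> / 2 * E t) *\<^sub>R y t = Abar *v x t - G *v s t"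
      by (simp add: N x_def s_def matrix_vector_mult_scaleR scaleR_add_right scaleR_diff_right mult.commute
          vector_matrix_mult_0 linear_neg[OF matrix_vector_mul_linear])
    finally show ?thesis .
  qed
  have s': "(s has_vector_derivative (\<rho> *\<^sub>R s t - transpose Abar *v s t + Q *v x t)) (at t within {0..})" if "t \<ge> 0" for t
  proof -
    have "(s has_vector_derivative - (E t *\<^sub>R (- (Q *v y t) - transpose N *v q t) + (\<rho> / 2 * E t) *\<^sub>R q t)) (at t within {0..})"
      unfolding s_def
      by (intro has_vector_derivative_minus
          bounded_bilinear.has_vector_derivative[OF bounded_bilinear_scaleR E' q'[OF that]])
    also have "- (E t *\<^sub>R (- (Q *v y t) - transpose N *v q t) + (\<rho> / 2 * E t) *\<^sub>R q t)
        = \<rho> *\<^sub>R s t - transpose Abar *v s t + Q *v x t"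
    proof -
      \<comment> \<open>One half comes from differentiating \<open>E\<close>, the other from the
        shift inside \<open>transpose N\<close>. In the equation for \<open>x\<close> the two halves
        cancel instead.\<close>
      have "\<rho> *\<^sub>R s t = - ((\<rho> / 2 * E t) *\<^sub>R q t) - ((\<rho> / 2 * E t) *\<^sub>R q t)"
      proof -
        have "\<rho> *\<^sub>R s t = - ((\<rho> / 2 * E t + \<rho> / 2 * E t) *\<^sub>R q t)" by (simp add: s_def)
        then show ?thesis unfolding scaleR_add_left by simp
      qed
      then show ?thesis
        by (simp add: N x_def s_def matrix_vector_mult_scaleR scaleR_add_right scaleR_diff_right mult.commute
          linear_neg[OF matrix_vector_mul_linear] del: transpose_matrix_vector)
    qed
    finally show ?thesis .
  qed
  have cont: "continuous_on {0..} (\<lambda>t. (s t, x t))"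
    using s' x' has_vector_derivative_continuous
    by (intro continuous_on_Pair) (force simp: continuous_on_eq_continuous_within)+
  have "set_integrable lborel {0..} (\<lambda>t. exp (- \<rho> * t) * (norm (s t, x t))\<^sup>2)"
  proof (rule set_integrable_bound)
    show "set_integrable lborel {0..} (\<lambda>t. (2 * c\<^sup>2) * exp (- (2 * a) * t))"
      using a by (intro set_integrable_exp_atLeast) simp
    show "set_borel_measurable lborel {0..} (\<lambda>t. exp (- \<rho> * t) * (norm (s t, x t))\<^sup>2)"
      unfolding set_borel_measurable_def measurable_lborel2
      by (intro borel_measurable_continuous_on_indicator continuous_intros cont) auto
    have "exp (- \<rho> * t) * (norm (s t, x t))\<^sup>2 \<le> (2 * c\<^sup>2) * exp (- (2 * a) * t)" if "t \<ge> 0" for t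
    proof -
      have "(norm (s t, x t))\<^sup>2 = (E t)\<^sup>2 * ((norm (q t))\<^sup>2 + (norm (y t))\<^sup>2)"
        by (simp add: norm_Pair s_def x_def power_mult_distrib distrib_left)
      moreover have "exp (- \<rho> * t) * (E t)\<^sup>2 = 1"
        by (simp add: E_def power2_eq_square mult_exp_exp)
      ultimately have "exp (- \<rho> * t) * (norm (s t, x t))\<^sup>2 = (norm (q t))\<^sup>2 + (norm (y t))\<^sup>2"
        by (simp add: mult.assoc[symmetric])
      also have "\<dots> \<le> (c * exp (- a * t))\<^sup>2 + (c * exp (- a * t))\<^sup>2"
        using b that by (intro add_mono power_mono) auto
      also have "\<dots> = (2 * c\<^sup>2) * exp (- (2 * a) * t)"
        by (simp add: power_mult_distrib power2_eq_square mult_exp_exp)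
      finally show ?thesis .
    qed
    then show "AE t in lborel. t \<in> {0..} \<longrightarrow> norm (exp (- \<rho> * t) * (norm (s t, x t))\<^sup>2)
        \<le> norm ((2 * c\<^sup>2) * exp (- (2 * a) * t))"
      by (simp add: abs_mult)
  qed
  with cont have "(\<lambda>t. (s t, x t)) \<in> C_half \<rho>" by (simp add: C_half_def)
  moreover have "x 0 = x0" by (simp add: x_def E_def y0)
  ultimately have "mean_field_solution \<rho> Abar G Q x0 s x"
    unfolding mean_field_solution_def using s' x' by force
  then show ?thesis by blast
qed

section \<open>Means of Ito integrals and of linear stochastic equations\<close>

lemma (in brownian_motion) F_measurableD:
  assumes "f \<in> measurable (F t) N" "0 \<le> t"
  shows "f \<in> measurable \<Omega> N"
  using measurable_from_subalg[OF subalgebra_F] assms by blast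

lemma simple_data_nonneg:
  assumes "simple_data \<Omega> F T k \<tau> \<xi>" "i \<le> k"
  shows "0 \<le> \<tau> i"
  using assms(2)
proof (induction i)
  case 0
  then show ?case using assms(1) by (simp add: simple_data_def)
next
  case (Suc i)
  then have "\<tau> i \<le> \<tau> (Suc i)" using assms(1) by (simp add: simple_data_def)
  then show ?case using Suc by simp
qed

lemma (in brownian_motion) increment_moments:
  assumes "0 \<le> s" "s < t"
  shows "integrable \<Omega> (\<lambda>\<omega>. W t \<omega> - W s \<omega>)" "expectation (\<lambda>\<omega>. W t \<omega> - W s \<omega>) = 0"
proof -
  note D = increments_W[OF assms]
  show "integrable \<Omega> (\<lambda>\<omega>. W t \<omega> - W s \<omega>)"
    by (rule distributed_integrable_var[OF D]) (use assms in \<open>auto intro!: integrable_normal_moment_nz_1\<close>)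
  show "expectation (\<lambda>\<omega>. W t \<omega> - W s \<omega>) = 0"
    by (rule normal_distributed_expectation[OF _ D]) (use assms in auto)
qed

text \<open>Preimages under \<open>Y\<close> lie in \<open>F s\<close>, so \<open>Y\<close> is
  independent of the increment, and the expectation factors through the zero mean of the
  increment.\<close>

lemma (in brownian_motion) increment_times_adapted:
  fixes Y :: "'w \<Rightarrow> real"
  assumes st: "0 \<le> s" "s < t" and Y: "Y \<in> borel_measurable (F s)" "bounded (Y ` space \<Omega>)"
  shows "integrable \<Omega> (\<lambda>\<omega>. (W t \<omega> - W s \<omega>) * Y \<omega>)" "expectation (\<lambda>\<omega>. (W t \<omega> - W s \<omega>) * Y \<omega>) = 0"
proof -
  let ?X = "\<lambda>\<omega>. W t \<omega> - W s \<omega>"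
  have space: "space (F s) = space \<Omega>" using subalgebra_F[OF st(1)] by (simp add: subalgebra_def)
  have Y': "random_variable borel Y" using F_measurableD[OF Y(1) st(1)] .
  have X: "random_variable borel ?X" using increment_moments(1)[OF st] by measurable
  have ind: "indep_set (sets (F s)) {?X -` S \<inter> space \<Omega> | S. S \<in> sets borel}"
    by (rule indep_increments_W[OF st])
  have "indep_set {?X -` S \<inter> space \<Omega> | S. S \<in> sets borel} {Y -` S \<inter> space \<Omega> | S. S \<in> sets borel}"
  proof (rule indep_setI)
    show "prob (a \<inter> b) = prob a * prob b"
      if "a \<in> {?X -` S \<inter> space \<Omega> | S. S \<in> sets borel}" "b \<in> {Y -` S \<inter> space \<Omega> | S. S \<in> sets borel}" for a b
    proof -
      have "b \<in> sets (F s)" using that(2) measurable_sets[OF Y(1)] by (auto simp: space)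
      from indep_setD[OF ind this that(1)] show ?thesis by (simp add: Int_commute mult.commute)
    qed
  qed (use measurable_sets[OF X] measurable_sets[OF Y'] in auto)
  then have "indep_var borel ?X borel Y"
    unfolding indep_var_eq using X Y'
    by (intro conjI indep_set_sigma_sets) (auto simp: Int_stable_def intro: exI[where x = "_ \<inter> _"])
  moreover have "integrable \<Omega> Y"
  proof -
    obtain B where "\<And>\<omega>. \<omega> \<in> space \<Omega> \<Longrightarrow> norm (Y \<omega>) \<le> B" using Y(2) by (auto simp: bounded_iff)
    then show ?thesis using Y' by (intro integrable_const_bound[of _ B]) auto
  qed
  ultimately show "integrable \<Omega> (\<lambda>\<omega>. (W t \<omega> - W s \<omega>) * Y \<omega>)" "expectation (\<lambda>\<omega>. (W t \<omega> - W s \<omega>) * Y \<omega>) = 0"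
    using indep_var_integrable[of ?X Y] indep_var_lebesgue_integral[of ?X Y] increment_moments[OF st] by auto
qed

lemma (in brownian_motion) simple_integral_moments:
  fixes \<xi> :: "nat \<Rightarrow> 'w \<Rightarrow> 'b::euclidean_space"
  assumes S: "simple_data \<Omega> F T k \<tau> \<xi>"
  shows "integrable \<Omega> (simple_integral W k \<tau> \<xi>)" "expectation (simple_integral W k \<tau> \<xi>) = 0"
proof -
  let ?f = "\<lambda>i \<omega>. (W (\<tau> (Suc i)) \<omega> - W (\<tau> i) \<omega>) *\<^sub>R \<xi> i \<omega>"
  have f: "integrable \<Omega> (?f i) \<and> expectation (?f i) = 0" if i: "i < k" for i
  proof (cases "\<tau> i = \<tau> (Suc i)")
    \<comment> \<open>Simple data may contain degenerate intervals. Their summand is zero and is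
      treated apart, since the law of increments is given only for \<open>s < t\<close>.\<close>
    case False
    have \<tau>: "0 \<le> \<tau> i" "\<tau> i < \<tau> (Suc i)"
      using simple_data_nonneg[OF S, of i] S i False by (auto simp: simple_data_def le_less)
    have \<xi>: "\<xi> i \<in> borel_measurable (F (\<tau> i))" "bounded (\<xi> i ` space \<Omega>)"
      using S i by (auto simp: simple_data_def)
    have b: "bounded ((\<lambda>\<omega>. \<xi> i \<omega> \<bullet> b) ` space \<Omega>)" for b
      using bounded_linear_image[OF \<xi>(2) bounded_linear_inner_left[of b]] by (simp add: image_image)
    have m: "(\<lambda>\<omega>. \<xi> i \<omega> \<bullet> b) \<in> borel_measurable (F (\<tau> i))" for b
      using \<xi>(1) by measurable
    note mom = increment_times_adapted[OF \<tau> m b]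
    have int: "integrable \<Omega> (?f i)"
    proof -
      obtain B where B: "\<And>\<omega>. \<omega> \<in> space \<Omega> \<Longrightarrow> norm (\<xi> i \<omega>) \<le> B" using \<xi>(2) by (auto simp: bounded_iff)
      have "integrable \<Omega> (\<lambda>\<omega>. B * (W (\<tau> (Suc i)) \<omega> - W (\<tau> i) \<omega>))"
        using increment_moments(1)[OF \<tau>] by simp
      then show ?thesis
      proof (rule Bochner_Integration.integrable_bound)
        show "?f i \<in> borel_measurable \<Omega>"
          using F_measurableD[OF \<xi>(1) \<tau>(1)] increment_moments(1)[OF \<tau>] by measurable
        show "AE \<omega> in \<Omega>. norm (?f i \<omega>) \<le> norm (B * (W (\<tau> (Suc i)) \<omega> - W (\<tau> i) \<omega>))"
        proof (intro AE_I2)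
          fix \<omega> assume "\<omega> \<in> space \<Omega>"
          then have "norm (\<xi> i \<omega>) \<le> \<bar>B\<bar>" using B[of \<omega>] by linarith
          from mult_right_mono[OF this, of "\<bar>W (\<tau> (Suc i)) \<omega> - W (\<tau> i) \<omega>\<bar>"] show "norm (?f i \<omega>) \<le> norm (B * (W (\<tau> (Suc i)) \<omega> - W (\<tau> i) \<omega>))"
            by (simp add: abs_mult mult.commute)
        qed
      qed
    qed
    have "expectation (?f i) = 0"
    proof (rule euclidean_eqI)
      fix b :: 'b
      have "expectation (?f i) \<bullet> b = expectation (\<lambda>\<omega>. ?f i \<omega> \<bullet> b)"
        by (rule integral_inner_left[symmetric]) (rule int)
      also have "\<dots> = 0" using mom(2)[of b] by simp
      finally show "expectation (?f i) \<bullet> b = 0 \<bullet> b" by simp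
    qed
    with int show ?thesis by simp
  qed simp
  have eq: "simple_integral W k \<tau> \<xi> = (\<lambda>\<omega>. \<Sum>i<k. ?f i \<omega>)"
    by (simp add: simple_integral_def fun_eq_iff)
  show "integrable \<Omega> (simple_integral W k \<tau> \<xi>)" unfolding eq using f by (intro Bochner_Integration.integrable_sum) auto
  show "expectation (simple_integral W k \<tau> \<xi>) = 0" unfolding eq using f by (subst Bochner_Integration.integral_sum) auto
qed

lemma (in prob_space) integrable_if_square_integrable:
  fixes f :: "'a \<Rightarrow> 'b::{banach, second_countable_topology}"
  assumes [measurable]: "f \<in> borel_measurable M" and "(\<integral>\<^sup>+\<omega>. ennreal ((norm (f \<omega>))\<^sup>2) \<partial>M) < \<infinity>"
  shows "integrable M f"
proof -
  have "integrable M (\<lambda>\<omega>. (norm (f \<omega>))\<^sup>2)"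
    using assms(2) by (intro integrableI_bounded) auto
  then have "integrable M (\<lambda>\<omega>. 1 + (norm (f \<omega>))\<^sup>2)" by simp
  then show ?thesis
  proof (rule Bochner_Integration.integrable_bound)
    have "x \<le> 1 + x\<^sup>2" if "x \<ge> 0" for x :: real
      using sum_squares_bound[of x 1] that by (simp add: power2_eq_square)
    then show "AE \<omega> in M. norm (f \<omega>) \<le> norm (1 + (norm (f \<omega>))\<^sup>2)" by (simp add: abs_of_nonneg)
  qed simp
qed

text \<open>Jensen's inequality for the squared norm, from integrating
  \<open>0 \<le> |f - v|\<^sup>2\<close> with \<open>v\<close> the mean. The right side may be
  infinite.\<close>

lemma (in prob_space) norm_expectation_le:
  fixes f :: "'a \<Rightarrow> 'b::euclidean_space"
  assumes int: "integrable M f"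
  shows "ennreal ((norm (expectation f))\<^sup>2) \<le> (\<integral>\<^sup>+\<omega>. ennreal ((norm (f \<omega>))\<^sup>2) \<partial>M)"
proof (cases "(\<integral>\<^sup>+\<omega>. ennreal ((norm (f \<omega>))\<^sup>2) \<partial>M) < \<infinity>")
  case True
  have [measurable]: "f \<in> borel_measurable M" using int by simp
  have int2: "integrable M (\<lambda>\<omega>. (norm (f \<omega>))\<^sup>2)"
    using True by (intro integrableI_bounded) auto
  let ?v = "expectation f"
  have "(norm ?v)\<^sup>2 = expectation (\<lambda>\<omega>. 2 * (f \<omega> \<bullet> ?v) - (norm ?v)\<^sup>2)"
    using int by (simp add: prob_space power2_norm_eq_inner)
  also have "\<dots> \<le> expectation (\<lambda>\<omega>. (norm (f \<omega>))\<^sup>2)"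
  proof (rule integral_mono)
    show "2 * (f \<omega> \<bullet> ?v) - (norm ?v)\<^sup>2 \<le> (norm (f \<omega>))\<^sup>2" for \<omega>
      using inner_ge_zero[of "f \<omega> - ?v"]
      by (simp add: power2_norm_eq_inner inner_diff inner_commute)
  qed (use int int2 in auto)
  finally have "ennreal ((norm ?v)\<^sup>2) \<le> ennreal (expectation (\<lambda>\<omega>. (norm (f \<omega>))\<^sup>2))"
    by (rule ennreal_leI)
  also have "\<dots> = (\<integral>\<^sup>+\<omega>. ennreal ((norm (f \<omega>))\<^sup>2) \<partial>M)"
    using int2 by (intro nn_integral_eq_integral[symmetric]) auto
  finally show ?thesis .
next
  case False
  then have "(\<integral>\<^sup>+\<omega>. ennreal ((norm (f \<omega>))\<^sup>2) \<partial>M) = \<top>"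
    by (metis infinity_ennreal_def top.not_eq_extremum)
  then show ?thesis by simp
qed

text \<open>The mean is continuous under mean-square convergence, and the approximating simple
  integrals are centred.\<close>

lemma (in brownian_motion) has_ito_integral_moments:
  fixes I :: "'w \<Rightarrow> 'b::euclidean_space"
  assumes "has_ito_integral \<Omega> F W T f I"
  shows "integrable \<Omega> I" "expectation I = 0"
proof -
  obtain k \<tau> and \<xi> :: "nat \<Rightarrow> nat \<Rightarrow> 'w \<Rightarrow> 'b" where S: "\<And>m. simple_data \<Omega> F T (k m) (\<tau> m) (\<xi> m)"
    and lim: "(\<lambda>m. \<integral>\<^sup>+\<omega>. ennreal ((norm (I \<omega> - simple_integral W (k m) (\<tau> m) (\<xi> m) \<omega>))\<^sup>2) \<partial>\<Omega>) \<longlonglongrightarrow> 0"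
    and I[measurable]: "I \<in> borel_measurable \<Omega>"
    using assms unfolding has_ito_integral_def by blast
  define J where "J = (\<lambda>m. simple_integral W (k m) (\<tau> m) (\<xi> m))"
  define e where "e = (\<lambda>m. \<integral>\<^sup>+\<omega>. ennreal ((norm (I \<omega> - J m \<omega>))\<^sup>2) \<partial>\<Omega>)"
  have lim: "e \<longlonglongrightarrow> 0" using lim by (simp add: e_def J_def)
  have J: "integrable \<Omega> (J m)" "expectation (J m) = 0" for m
    unfolding J_def by (rule simple_integral_moments[OF S])+
  have diff: "integrable \<Omega> (\<lambda>\<omega>. I \<omega> - J m \<omega>)" if "e m < \<infinity>" for m
    using that J(1)[of m] unfolding e_def
    by (intro integrable_if_square_integrable) auto
  \<comment> \<open>Convergence to 0 in the extended reals leaves finitely many distances possibly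
    infinite, so square integrability of the difference is available only eventually.\<close>
  have fin: "\<forall>\<^sub>F m in sequentially. e m < \<infinity>"
    using order_tendstoD(2)[OF lim, of \<infinity>] by simp
  then obtain m where "e m < \<infinity>" by (auto simp: eventually_sequentially)
  from Bochner_Integration.integrable_add[OF diff[OF this] J(1)[of m]]
  show int: "integrable \<Omega> I" by simp
  have "ennreal ((norm (expectation I))\<^sup>2) \<le> e m" if "e m < \<infinity>" for m
    using norm_expectation_le[OF diff[OF that]] int J[of m] by (simp add: e_def)
  with fin have "\<forall>\<^sub>F m in sequentially. ennreal ((norm (expectation I))\<^sup>2) \<le> e m"
    by (auto elim: eventually_mono)
  from tendsto_lowerbound[OF lim this] have "ennreal ((norm (expectation I))\<^sup>2) \<le> 0" by simp
  then show "expectation I = 0" by simp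
qed

text \<open>Rounding time down to the grid of width \<open>1 / (n + 1)\<close> gives countably many
  values, hence a jointly measurable map; path continuity passes this to the limit.\<close>

lemma borel_measurable_pair_if_continuous:
  fixes Y :: "real \<Rightarrow> 'w \<Rightarrow> 'b::metric_space"
  assumes meas: "\<And>t. Y t \<in> borel_measurable M"
    and cont: "\<And>\<omega>. \<omega> \<in> space M \<Longrightarrow> continuous_on UNIV (\<lambda>t. Y t \<omega>)"
  shows "(\<lambda>(t, \<omega>). Y t \<omega>) \<in> borel_measurable (lborel \<Otimes>\<^sub>M M)"
proof (rule borel_measurable_LIMSEQ_metric)
  let ?r = "\<lambda>n t. real_of_int \<lfloor>real (Suc n) * t\<rfloor> / real (Suc n)"
  show "(\<lambda>p. Y (?r n (fst p)) (snd p)) \<in> borel_measurable (lborel \<Otimes>\<^sub>M M)" for n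
  proof (rule measurable_compose_countable[where g = "\<lambda>p. \<lfloor>real (Suc n) * fst p\<rfloor>"])
    show "(\<lambda>p. Y (real_of_int i / real (Suc n)) (snd p)) \<in> borel_measurable (lborel \<Otimes>\<^sub>M M)" for i
      by (rule measurable_compose[OF measurable_snd meas])
    show "(\<lambda>p. \<lfloor>real (Suc n) * fst p\<rfloor>) \<in> measurable (lborel \<Otimes>\<^sub>M M) (count_space UNIV)"
      by measurable
  qed
  fix p :: "real \<times> 'w" assume "p \<in> space (lborel \<Otimes>\<^sub>M M)"
  then have c: "isCont (\<lambda>t. Y t (snd p)) (fst p)"
    using cont[of "snd p"] by (auto simp: space_pair_measure continuous_on_eq_continuous_at)
  have "(\<lambda>n. ?r n (fst p)) \<longlonglongrightarrow> fst p"
  proof (rule tendsto_sandwich)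
    show "\<forall>\<^sub>F n in sequentially. fst p - 1 / real (Suc n) \<le> ?r n (fst p)"
    proof (intro always_eventually allI)
      fix n
      have "real (Suc n) * fst p - 1 \<le> real_of_int \<lfloor>real (Suc n) * fst p\<rfloor>" by linarith
      then have "(real (Suc n) * fst p - 1) / real (Suc n) \<le> ?r n (fst p)"
        by (rule divide_right_mono) simp
      then show "fst p - 1 / real (Suc n) \<le> ?r n (fst p)" by (simp add: diff_divide_distrib)
    qed
    show "\<forall>\<^sub>F n in sequentially. ?r n (fst p) \<le> fst p"
    proof (intro always_eventually allI)
      fix n
      have "?r n (fst p) \<le> (real (Suc n) * fst p) / real (Suc n)"
        by (rule divide_right_mono) simp_all
      then show "?r n (fst p) \<le> fst p" by simp
    qed
    show "(\<lambda>n. fst p - 1 / real (Suc n)) \<longlonglongrightarrow> fst p"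
      using tendsto_diff[OF tendsto_const LIMSEQ_inverse_real_of_nat] by (simp add: inverse_eq_divide)
  qed simp
  from isCont_tendsto_compose[OF c this]
  show "(\<lambda>n. Y (?r n (fst p)) (snd p)) \<longlonglongrightarrow> (case p of (t, \<omega>) \<Rightarrow> Y t \<omega>)"
    by (simp add: case_prod_beta)
qed

text \<open>Taking expectations removes the Ito term, and Fubini moves the mean inside the drift, so
  the mean solves \<open>v' = A v\<close> whatever \<open>C\<close> is.\<close>

lemma (in brownian_motion) linear_sde_solution_mean:
  fixes x :: "real \<Rightarrow> 'w \<Rightarrow> real^'n"
  assumes sol: "linear_sde_solution \<Omega> F W A C x0 x"
  defines "v \<equiv> \<lambda>t. expectation (x t)"
  shows "\<And>t. t \<ge> 0 \<Longrightarrow> integrable \<Omega> (x t)"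
    and "v 0 = x0"
    and "\<And>t. t \<ge> 0 \<Longrightarrow> (v has_vector_derivative A *v v t) (at t within {0..})"
    and "(\<lambda>(t, \<omega>). x (max 0 t) \<omega>) \<in> borel_measurable (lborel \<Otimes>\<^sub>M \<Omega>)"
proof -
  interpret P: pair_sigma_finite lborel \<Omega> ..
  \<comment> \<open>Nothing is known about \<open>x\<close> at negative times; freezing it at time 0
    gives paths continuous on the whole line.\<close>
  let ?Y = "\<lambda>t. x (max 0 t)"
  have meas: "?Y t \<in> borel_measurable \<Omega>" for t
    using sol by (intro F_measurableD[of _ "max 0 t"]) (auto simp: linear_sde_solution_def)
  have cont: "continuous_on UNIV (\<lambda>t. ?Y t \<omega>)" if "\<omega> \<in> space \<Omega>" for \<omega>
  proof (rule continuous_on_compose2[where f = "max 0" and g = "\<lambda>t. x t \<omega>" and t = "{0..}"])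
    show "continuous_on {0..} (\<lambda>t. x t \<omega>)" using sol that by (simp add: linear_sde_solution_def)
  qed (auto intro!: continuous_intros)
  show meas_pair [measurable]: "(\<lambda>(t, \<omega>). ?Y t \<omega>) \<in> borel_measurable (lborel \<Otimes>\<^sub>M \<Omega>)"
    by (rule borel_measurable_pair_if_continuous[OF meas cont])
  define f where "f = (\<lambda>T (t, \<omega>). indicator {0..T} t *\<^sub>R ?Y t \<omega>)"
  have f_meas [measurable]: "f T \<in> borel_measurable (lborel \<Otimes>\<^sub>M \<Omega>)" for T :: real
    unfolding f_def split_beta' using meas_pair unfolding split_beta' by measurable
  have f_int: "integrable (lborel \<Otimes>\<^sub>M \<Omega>) (f T)" if T: "T \<ge> 0" for T
  proof (rule integrableI_bounded)
    let ?g = "\<lambda>(t, \<omega>). indicator {0..T} t + ennreal ((norm (?Y t \<omega>))\<^sup>2) * indicator {0..T} t"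
    have "ennreal (norm (f T p)) \<le> ?g p" for p
    proof -
      have "r \<le> 1 + r\<^sup>2" if "r \<ge> 0" for r :: real
        using sum_squares_bound[of r 1] that by (simp add: power2_eq_square)
      then have "ennreal (norm (?Y (fst p) (snd p))) \<le> 1 + ennreal ((norm (?Y (fst p) (snd p)))\<^sup>2)"
        by (metis ennreal_1 ennreal_leI ennreal_plus norm_ge_zero zero_le_one zero_le_power2)
      then show ?thesis by (auto simp: f_def split_beta' indicator_def)
    qed
    then have "(\<integral>\<^sup>+p. ennreal (norm (f T p)) \<partial>(lborel \<Otimes>\<^sub>M \<Omega>)) \<le> (\<integral>\<^sup>+p. ?g p \<partial>(lborel \<Otimes>\<^sub>M \<Omega>))"
      by (intro nn_integral_mono)
    also have "\<dots> = (\<integral>\<^sup>+\<omega>. (\<integral>\<^sup>+t. ?g (t, \<omega>) \<partial>lborel) \<partial>\<Omega>)"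
      using meas_pair by (intro P.nn_integral_snd[symmetric]) (simp add: split_beta', measurable)
    also have "\<dots> = (\<integral>\<^sup>+\<omega>. ennreal T + (\<integral>\<^sup>+t\<in>{0..T}. ennreal ((norm (x t \<omega>))\<^sup>2) \<partial>lborel) \<partial>\<Omega>)"
    proof (rule nn_integral_cong)
      fix \<omega> assume \<omega>: "\<omega> \<in> space \<Omega>"
      have [measurable]: "(\<lambda>t. ?Y t \<omega>) \<in> borel_measurable borel"
        using cont[OF \<omega>] by (rule borel_measurable_continuous_onI)
      have "(\<integral>\<^sup>+t. ?g (t, \<omega>) \<partial>lborel)
          = ennreal T + (\<integral>\<^sup>+t\<in>{0..T}. ennreal ((norm (?Y t \<omega>))\<^sup>2) \<partial>lborel)"
        using T by (simp add: nn_integral_add)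
      also have "(\<integral>\<^sup>+t\<in>{0..T}. ennreal ((norm (?Y t \<omega>))\<^sup>2) \<partial>lborel)
          = (\<integral>\<^sup>+t\<in>{0..T}. ennreal ((norm (x t \<omega>))\<^sup>2) \<partial>lborel)"
        by (intro nn_integral_cong) (auto simp: indicator_def max_def)
      finally show "(\<integral>\<^sup>+t. ?g (t, \<omega>) \<partial>lborel)
          = ennreal T + (\<integral>\<^sup>+t\<in>{0..T}. ennreal ((norm (x t \<omega>))\<^sup>2) \<partial>lborel)" .
    qed
    also have "\<dots> \<le> ennreal T + (\<integral>\<^sup>+\<omega>. (\<integral>\<^sup>+t\<in>{0..T}. ennreal ((norm (x t \<omega>))\<^sup>2) \<partial>lborel) \<partial>\<Omega>)"
    proof -
      have "(\<lambda>\<omega>. \<integral>\<^sup>+t\<in>{0..T}. ennreal ((norm (?Y t \<omega>))\<^sup>2) \<partial>lborel) \<in> borel_measurable \<Omega>"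
        using meas_pair unfolding split_beta' by measurable
      moreover have "(\<integral>\<^sup>+t\<in>{0..T}. ennreal ((norm (?Y t \<omega>))\<^sup>2) \<partial>lborel)
          = (\<integral>\<^sup>+t\<in>{0..T}. ennreal ((norm (x t \<omega>))\<^sup>2) \<partial>lborel)" for \<omega>
        by (intro nn_integral_cong) (auto simp: indicator_def max_def)
      ultimately show ?thesis by (subst nn_integral_add) (auto simp: emeasure_space_1)
    qed
    also have "\<dots> < \<infinity>" using sol T by (simp add: linear_sde_solution_def)
    finally show "(\<integral>\<^sup>+p. ennreal (norm (f T p)) \<partial>(lborel \<Otimes>\<^sub>M \<Omega>)) < \<infinity>" .
  qed simp
  have Af_int: "integrable (lborel \<Otimes>\<^sub>M \<Omega>) (\<lambda>(t, \<omega>). indicator {0..T} t *\<^sub>R (A *v x t \<omega>))" if "T \<ge> 0" for T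
  proof -
    have "(\<lambda>(t, \<omega>). indicator {0..T} t *\<^sub>R (A *v x t \<omega>)) = (\<lambda>p. A *v f T p)"
      by (auto simp: f_def fun_eq_iff indicator_def max_def)
    then show ?thesis
      using integrable_bounded_linear[OF matrix_vector_mul_bounded_linear f_int[OF that]] by simp
  qed
  have drift_int: "integrable \<Omega> (\<lambda>\<omega>. LINT s:{0..t}|lborel. A *v x s \<omega>)" if "t \<ge> 0" for t
    using P.integrable_snd[OF Af_int[OF that]] by (simp add: set_lebesgue_integral_def)
  have eq: "\<exists>I. integrable \<Omega> I \<and> expectation I = 0 \<and>
      (AE \<omega> in \<Omega>. x t \<omega> = x0 + (LINT s:{0..t}|lborel. A *v x s \<omega>) + I \<omega>)" if "t \<ge> 0" for t
  proof -
    obtain I where "has_ito_integral \<Omega> F W t (\<lambda>s \<omega>. C *v x s \<omega>) I"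
        "AE \<omega> in \<Omega>. x t \<omega> = x0 + (LINT s:{0..t}|lborel. A *v x s \<omega>) + I \<omega>"
      using sol \<open>t \<ge> 0\<close> unfolding linear_sde_solution_def by blast
    then show ?thesis using has_ito_integral_moments by blast
  qed
  have meas': "x t \<in> borel_measurable \<Omega>" if "t \<ge> 0" for t
    using meas[of t] that by (simp add: max_def)
  \<comment> \<open>The solution class bounds the second moment only after integration over time, so
    integrability at a fixed time is read off from the integral equation.\<close>
  show int: "integrable \<Omega> (x t)" if "t \<ge> 0" for t
  proof -
    obtain I where I: "integrable \<Omega> I"
        "AE \<omega> in \<Omega>. x t \<omega> = x0 + (LINT s:{0..t}|lborel. A *v x s \<omega>) + I \<omega>"
      using eq[OF \<open>t \<ge> 0\<close>] by blast
    have "integrable \<Omega> (\<lambda>\<omega>. x0 + (LINT s:{0..t}|lborel. A *v x s \<omega>) + I \<omega>)"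
      using drift_int[OF that] I(1) by simp
    then show ?thesis
      using integrable_cong_AE[OF meas'[OF that] borel_measurable_integrable I(2)] by blast
  qed
  have v: "v t = x0 + (LINT s:{0..t}|lborel. A *v v s)" if "t \<ge> 0" for t
  proof -
    obtain I where I: "integrable \<Omega> I" "expectation I = 0"
        "AE \<omega> in \<Omega>. x t \<omega> = x0 + (LINT s:{0..t}|lborel. A *v x s \<omega>) + I \<omega>"
      using eq[OF \<open>t \<ge> 0\<close>] by blast
    have "v t = expectation (\<lambda>\<omega>. x0 + (LINT s:{0..t}|lborel. A *v x s \<omega>) + I \<omega>)"
      unfolding v_def using drift_int[OF that] I by (intro integral_cong_AE meas' that) auto
    also have "\<dots> = x0 + expectation (\<lambda>\<omega>. LINT s:{0..t}|lborel. A *v x s \<omega>)"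
      using drift_int[OF that] I by (simp add: prob_space)
    also have "expectation (\<lambda>\<omega>. LINT s:{0..t}|lborel. A *v x s \<omega>)
        = (LINT s|lborel. expectation (\<lambda>\<omega>. indicator {0..t} s *\<^sub>R (A *v x s \<omega>)))"
      unfolding set_lebesgue_integral_def using P.Fubini_integral[OF Af_int[OF that]] .
    also have "\<dots> = (LINT s:{0..t}|lborel. A *v v s)"
      unfolding set_lebesgue_integral_def
    proof (rule Bochner_Integration.integral_cong)
      show "expectation (\<lambda>\<omega>. indicator {0..t} s *\<^sub>R (A *v x s \<omega>)) = indicator {0..t} s *\<^sub>R (A *v v s)" for s
        using integral_bounded_linear[OF matrix_vector_mul_bounded_linear int, of s A]
        by (cases "s \<in> {0..t}") (auto simp: v_def)
    qed simp
    finally show ?thesis .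
  qed
  have v_int: "set_integrable lborel {0..T} (\<lambda>s. A *v v s)" if "T \<ge> 0" for T
  proof -
    have "integrable lborel (\<lambda>s. expectation (\<lambda>\<omega>. indicator {0..T} s *\<^sub>R (A *v x s \<omega>)))"
      using P.integrable_fst[OF Af_int[OF that]] .
    also have "(\<lambda>s. expectation (\<lambda>\<omega>. indicator {0..T} s *\<^sub>R (A *v x s \<omega>)))
        = (\<lambda>s. indicator {0..T} s *\<^sub>R (A *v v s))"
    proof
      show "expectation (\<lambda>\<omega>. indicator {0..T} s *\<^sub>R (A *v x s \<omega>)) = indicator {0..T} s *\<^sub>R (A *v v s)" for s
        using integral_bounded_linear[OF matrix_vector_mul_bounded_linear int, of s A]
        by (cases "s \<in> {0..T}") (auto simp: v_def)
    qed
    finally show ?thesis by (simp add: set_integrable_def)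
  qed
  have v_eq: "v t = x0 + integral {0..t} (\<lambda>s. A *v v s)" if "t \<ge> 0" for t
    using v[OF that] set_borel_integral_eq_integral(2)[OF v_int[OF that]] by simp
  show "v 0 = x0" using v_eq[of 0] by simp
  \<comment> \<open>Bootstrap: integrability of \<open>A v\<close> makes \<open>v\<close> continuous
    as an indefinite integral; the integrand is then continuous, and \<open>v\<close> is
    differentiable.\<close>
  have cont_T: "continuous_on {0..T} v" if "T \<ge> 0" for T
  proof -
    have "continuous_on {0..T} (\<lambda>t. x0 + integral {0..t} (\<lambda>s. A *v v s))"
      using set_borel_integral_eq_integral(1)[OF v_int[OF that]]
      by (intro continuous_intros indefinite_integral_continuous_1)
    then show ?thesis by (rule continuous_on_eq) (simp add: v_eq)
  qed
  have "continuous_on {0..} v"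
    unfolding continuous_on_eq_continuous_within
  proof
    fix t :: real assume t: "t \<in> {0..}"
    have "continuous (at t within {0..t+1}) v"
      using cont_T[of "t + 1"] t by (auto simp: continuous_on_eq_continuous_within)
    also have "at t within {0..t+1} = at t within {0..}"
      by (rule at_within_nhd[of _ "{..<t+1}"]) auto
    finally show "continuous (at t within {0..}) v" .
  qed
  then have c: "continuous_on {0..} (\<lambda>s. A *v v s)"
    by (intro bounded_linear.continuous_on[OF matrix_vector_mul_bounded_linear])
  show "(v has_vector_derivative A *v v t) (at t within {0..})" if "t \<ge> 0" for t
  proof -
    have "((\<lambda>t. x0 + integral {0..t} (\<lambda>s. A *v v s)) has_vector_derivative A *v v t) (at t within {0..})"
      using has_vector_derivative_add[OF has_vector_derivative_const ex_primitive_atLeast[OF c that]] by simp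
    then show ?thesis
      by (intro has_vector_derivative_transform[OF _ v_eq]) (use that in auto)
  qed
qed

text \<open>The mean of the solution grows like \<open>exp (\<mu> t)\<close> along a left eigenvector for \<open>\<mu>\<close>, and the
  second moment dominates the squared mean.\<close>

lemma (in brownian_motion) discounted_solution_left_eigenvector:
  fixes x :: "real \<Rightarrow> 'w \<Rightarrow> real^'n" and \<phi> :: "real^'n \<Rightarrow> complex"
  assumes sol: "linear_sde_solution \<Omega> F W A C x0 x"
    and fin: "(\<integral>\<^sup>+\<omega>. (\<integral>\<^sup>+t\<in>{0..}. ennreal (exp (- \<rho> * t) * (norm (x t \<omega>))\<^sup>2) \<partial>lborel) \<partial>\<Omega>) < \<infinity>"
    and \<phi>: "bounded_linear \<phi>" "\<And>v. \<phi> (A *v v) = \<mu> * \<phi> v" and \<mu>: "Re \<mu> \<ge> \<rho> / 2"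
  shows "\<phi> x0 = 0"
proof (rule ccontr)
  assume nz: "\<phi> x0 \<noteq> 0"
  interpret P: pair_sigma_finite lborel \<Omega> ..
  define v where "v = (\<lambda>t. expectation (x t))"
  note mean = linear_sde_solution_mean[OF sol]
  have v0: "v 0 = x0" using mean(2) by (simp add: v_def)
  have v': "(v has_vector_derivative A *v v t) (at t within {0..})" if "t \<ge> 0" for t
    using mean(3)[OF that] by (simp add: v_def)
  let ?Y = "\<lambda>t. x (max 0 t)"
  \<comment> \<open>Along the left eigenvector the mean obeys a scalar equation with rate
    \<open>\<mu>\<close>; multiplying by \<open>exp (- \<mu> t)\<close> makes it constant.\<close>
  define m where "m = (\<lambda>t. exp (- \<mu> * complex_of_real t) * \<phi> (v t))"
  have m': "(m has_vector_derivative 0) (at t within {0..})" if "t \<in> {0..}" for t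
  proof -
    have "(m has_vector_derivative exp (- \<mu> * complex_of_real t) * \<phi> (A *v v t)
        + (- \<mu> * exp (- \<mu> * complex_of_real t)) * \<phi> (v t)) (at t within {0..})"
      unfolding m_def using that
      by (intro bounded_bilinear.has_vector_derivative[OF bounded_bilinear_mult] has_vector_derivative_exp_times
          bounded_linear.has_vector_derivative[OF \<phi>(1)] v') simp
    then show ?thesis by (simp add: \<phi>(2))
  qed
  then obtain k where k: "\<And>t. t \<in> {0..} \<Longrightarrow> m t = k"
    using has_vector_derivative_zero_constant[of "{0..}" m] by (auto simp: convex_real_interval)
  have m: "m t = \<phi> x0" if "t \<ge> 0" for t
    using k[of t] k[of 0] that by (simp add: m_def v0)
  obtain K where K: "K > 0" "\<And>v. norm (\<phi> v) \<le> norm v * K"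
    using bounded_linear.pos_bounded[OF \<phi>(1)] by blast
  \<comment> \<open>With \<open>K\<close> bounding \<open>\<phi>\<close>, this is a time-independent
    lower bound for the discounted squared mean; a positive constant is not integrable over the
    half-line.\<close>
  define c where "c = (cmod (\<phi> x0) / K)\<^sup>2"
  have c: "c > 0" using nz K(1) by (simp add: c_def)
  have lower: "c \<le> exp (- \<rho> * t) * (norm (v t))\<^sup>2" if t: "t \<ge> 0" for t
  proof -
    have "cmod (\<phi> x0) = exp (- Re \<mu> * t) * cmod (\<phi> (v t))"
      unfolding m[OF t, symmetric] m_def by (simp add: norm_mult)
    also have "\<dots> \<le> exp (- (\<rho> / 2) * t) * (norm (v t) * K)"
      using mult_right_mono[OF \<mu> t] K(2)[of "v t"] by (intro mult_mono) (auto intro: mult_right_mono)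
    finally have "cmod (\<phi> x0) / K \<le> exp (- (\<rho> / 2) * t) * norm (v t)"
      using K(1) by (simp add: field_simps)
    then have "c \<le> (exp (- (\<rho> / 2) * t) * norm (v t))\<^sup>2"
      unfolding c_def using K(1) by (intro power_mono) auto
    also have "\<dots> = exp (- \<rho> * t) * (norm (v t))\<^sup>2"
      by (simp add: power_mult_distrib power2_eq_square[of "exp _"] mult_exp_exp)
    finally show ?thesis .
  qed
  have "\<infinity> = (\<integral>\<^sup>+t. ennreal c * indicator {0::real..} t \<partial>lborel)"
    using c by (simp add: nn_integral_cmult_indicator emeasure_lborel_atLeast ennreal_mult_top)
  also have "\<dots> \<le> (\<integral>\<^sup>+t. (\<integral>\<^sup>+\<omega>. ennreal (exp (- \<rho> * t) * (norm (?Y t \<omega>))\<^sup>2) * indicator {0..} t \<partial>\<Omega>) \<partial>lborel)"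
  proof (rule nn_integral_mono)
    fix t :: real
    show "ennreal c * indicator {0::real..} t
      \<le> (\<integral>\<^sup>+\<omega>. ennreal (exp (- \<rho> * t) * (norm (?Y t \<omega>))\<^sup>2) * indicator {0..} t \<partial>\<Omega>)"
    proof (cases "t \<ge> 0")
      case True
      have meas: "x t \<in> borel_measurable \<Omega>" using mean(1)[OF True] by simp
      have "ennreal c \<le> ennreal (exp (- \<rho> * t)) * ennreal ((norm (v t))\<^sup>2)"
        using lower[OF True] by (simp add: ennreal_leI flip: ennreal_mult)
      also have "\<dots> \<le> ennreal (exp (- \<rho> * t)) * (\<integral>\<^sup>+\<omega>. ennreal ((norm (x t \<omega>))\<^sup>2) \<partial>\<Omega>)"
        unfolding v_def by (intro mult_left_mono norm_expectation_le mean(1)[OF True]) simp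
      also have "\<dots> = (\<integral>\<^sup>+\<omega>. ennreal (exp (- \<rho> * t)) * ennreal ((norm (x t \<omega>))\<^sup>2) \<partial>\<Omega>)"
        using meas by (intro nn_integral_cmult[symmetric]) measurable
      finally show ?thesis using True by (simp add: ennreal_mult max_def)
    qed simp
  qed
  also have "\<dots> = (\<integral>\<^sup>+\<omega>. (\<integral>\<^sup>+t. ennreal (exp (- \<rho> * t) * (norm (?Y t \<omega>))\<^sup>2) * indicator {0..} t \<partial>lborel) \<partial>\<Omega>)"
  proof -
    have "(\<lambda>(t, \<omega>). ennreal (exp (- \<rho> * t) * (norm (?Y t \<omega>))\<^sup>2) * indicator {0..} t) \<in> borel_measurable (lborel \<Otimes>\<^sub>M \<Omega>)"
      using mean(4) unfolding split_beta' by measurable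
    from P.Fubini[OF this] show ?thesis by simp
  qed
  also have "\<dots> = (\<integral>\<^sup>+\<omega>. (\<integral>\<^sup>+t\<in>{0..}. ennreal (exp (- \<rho> * t) * (norm (x t \<omega>))\<^sup>2) \<partial>lborel) \<partial>\<Omega>)"
    by (intro nn_integral_cong) (auto simp: indicator_def max_def)
  finally show False using fin by simp
qed

section \<open>Inverse and adjoint of real matrices, and the main result\<close>

lemma Re_vec_zero: "Re_vec 0 = 0" and Im_vec_zero: "Im_vec 0 = 0"
  by (simp_all add: Re_vec_def Im_vec_def vec_eq_iff)

lemma pos_def_inverse:
  fixes S :: "real^'n^'n"
  assumes "pos_def S"
  shows "pos_def (matrix_inv S)"
proof -
  have inj: "inj ((*v) S)"
    unfolding linear_injective_0[OF matrix_vector_mul_linear]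
    using assms by (metis pos_def_def inner_zero_right less_irrefl)
  then have "invertible S" by (simp add: matrix_left_invertible_injective invertible_left_inverse)
  \<comment> \<open>\<open>matrix_inv\<close> is a choice operator; its two defining equations
    become available from invertibility.\<close>
  then have inv: "S ** matrix_inv S = mat 1" "matrix_inv S ** S = mat 1"
    using someI_ex[of "\<lambda>T. S ** T = mat 1 \<and> T ** S = mat 1"] by (auto simp: invertible_def matrix_inv_def)
  have sym: "transpose S = S" using assms by (simp add: pos_def_def)
  have tr: "transpose (matrix_inv S) = matrix_inv S"
  proof -
    have "transpose (matrix_inv S) ** S = mat 1"
      using arg_cong[OF inv(1), of transpose] sym by (simp add: matrix_transpose_mul)
    then have "transpose (matrix_inv S) ** (S ** matrix_inv S) = matrix_inv S"
      by (simp add: matrix_mul_assoc)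
    then show ?thesis by (simp add: inv)
  qed
  have "0 < x \<bullet> (matrix_inv S *v x)" if "x \<noteq> 0" for x
  proof -
    let ?y = "matrix_inv S *v x"
    have y: "S *v ?y = x" by (simp add: matrix_vector_mul_assoc inv)
    then have "?y \<noteq> 0" using that by auto
    then have "0 < ?y \<bullet> (S *v ?y)" using assms by (simp add: pos_def_def)
    then show ?thesis by (simp add: y inner_commute)
  qed
  with tr show ?thesis by (simp add: pos_def_def)
qed

lemma transpose_adjoint: "x \<bullet> (transpose M *v y) = (M *v x) \<bullet> y"
  for M :: "real^'n^'m"
  by (metis dot_lmul_matrix transpose_matrix_vector transpose_transpose)

theorem theorem3p2:
  fixes \<Omega> :: "'w measure" and F :: "real \<Rightarrow> 'w measure" and W :: "real \<Rightarrow> 'w \<Rightarrow> real"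
    and \<rho> :: real
    and A C Q P Abar G :: "real^'n^'n"
    and B D :: "real^'r^'n"
    and R :: "real^'r^'r"
    and xbar0 :: "real^'n"
  assumes brownian: "brownian_motion \<Omega> F W"
    and rho: "\<rho> \<ge> 0"
    and sym: "transpose Q = Q" "transpose R = R"
    and A3: "discounted_stabilizable \<Omega> F W \<rho> A B C D"
    and A4: "pos_def R" "pos_semidef Q"
      "exactly_detectable \<Omega> F W (A - (\<rho> / 2) *\<^sub>R mat 1) C (matrix_sqrt Q)"
    and P_psd: "pos_semidef P"
    and P_riccati: "\<rho> *\<^sub>R P = transpose A ** P + P ** A + transpose C ** P ** C + Q
      - transpose (transpose B ** P + transpose D ** P ** C)
        ** matrix_inv (R + transpose D ** P ** D)
        ** (transpose B ** P + transpose D ** P ** C)"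
    and Abar: "Abar = A - B ** matrix_inv (R + transpose D ** P ** D)
        ** (transpose B ** P + transpose D ** P ** C)"
    and G: "G = B ** matrix_inv (R + transpose D ** P ** D) ** transpose B"
    and no_imag: "\<And>l. complex_eigenvalue
        (block_matrix (Abar - (\<rho> / 2) *\<^sub>R mat 1) G (- Q) (- transpose Abar + (\<rho> / 2) *\<^sub>R mat 1)) l
        \<Longrightarrow> Re l \<noteq> 0"
  shows "\<exists>s xbar. mean_field_solution \<rho> Abar G Q xbar0 s xbar \<and>
    (\<forall>s' xbar'. mean_field_solution \<rho> Abar G Q xbar0 s' xbar' \<longrightarrow>
      (\<forall>t\<ge>0. s' t = s t \<and> xbar' t = xbar t))"
proof -
  interpret brownian_motion \<Omega> F W by (rule brownian)
  define S where "S = R + transpose D ** P ** D"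
  define N where "N = Abar - (\<rho> / 2) *\<^sub>R mat 1"
  have S: "pos_def S"
    unfolding pos_def_def
  proof (intro conjI allI impI)
    have "transpose S = transpose R + transpose (transpose D ** P ** D)"
      by (simp add: S_def transpose_def vec_eq_iff)
    then show "transpose S = S"
      using sym P_psd by (simp add: S_def pos_semidef_def matrix_transpose_mul matrix_mul_assoc)
    fix u :: "real^'r" assume "u \<noteq> 0"
    have "u \<bullet> (S *v u) = u \<bullet> (R *v u) + (D *v u) \<bullet> (P *v (D *v u))"
      by (simp add: S_def matrix_vector_mult_add_rdistrib inner_add_right transpose_adjoint
          matrix_vector_mul_assoc[symmetric] del: transpose_matrix_vector)
    then show "0 < u \<bullet> (S *v u)"
      using A4(1) P_psd \<open>u \<noteq> 0\<close> by (simp add: pos_def_def pos_semidef_def add_pos_nonneg)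
  qed
  note Si = pos_def_inverse[OF S]
  have G': "G = B ** matrix_inv S ** transpose B" by (simp add: G S_def)
  have quad: "x \<bullet> (G *v x) = (transpose B *v x) \<bullet> (matrix_inv S *v (transpose B *v x))" for x
    using transpose_adjoint[where M = "transpose B"]
    by (simp add: G' matrix_vector_mul_assoc[symmetric] transpose_transpose del: transpose_matrix_vector)
  have G_psd: "pos_semidef G"
    unfolding pos_semidef_def quad
  proof (intro conjI allI)
    show "transpose G = G"
      using Si by (simp add: G' matrix_transpose_mul transpose_transpose matrix_mul_assoc pos_def_def)
    show "0 \<le> (transpose B *v x) \<bullet> (matrix_inv S *v (transpose B *v x))" for x
      using Si unfolding pos_def_def by (cases "transpose B *v x = 0") (auto simp del: transpose_matrix_vector intro: less_imp_le)
  qed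
  \<comment> \<open>Definiteness of the inverse of \<open>S\<close> makes the form of
    \<open>G\<close> vanish only on the kernel of \<open>transpose B\<close>.\<close>
  have kernel: "transpose B *v x = 0" if "G *v x = 0" for x
  proof (rule ccontr)
    assume "transpose B *v x \<noteq> 0"
    then have "0 < x \<bullet> (G *v x)" unfolding quad using Si unfolding pos_def_def by blast
    with that show False by simp
  qed
  \<comment> \<open>The Hautus condition for the pair of \<open>N\<close> and \<open>B\<close>,
    phrased through \<open>G\<close>.\<close>
  have stab: "v = 0"
    if v: "complex_matrix (transpose N) *v v = l *s v" "Re l > 0" "complex_matrix G *v v = 0" for l v
  proof -
    obtain K :: "real^'n^'r" where K: "\<And>x0. \<exists>x. linear_sde_solution \<Omega> F W (A + B ** K) (C + D ** K) x0 x \<and>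
        (\<integral>\<^sup>+\<omega>. (\<integral>\<^sup>+t\<in>{0..}. ennreal (exp (- \<rho> * t) * (norm (x t \<omega>))\<^sup>2) \<partial>lborel) \<partial>\<Omega>) < \<infinity>"
      using A3 unfolding discounted_stabilizable_def by blast
    define a where "a = Re_vec v"
    define b where "b = Im_vec v"
    have B0: "transpose B *v a = 0" "transpose B *v b = 0"
      using kernel v(3) by (metis a_def b_def Re_vec_mult Im_vec_mult Re_vec_zero Im_vec_zero)+
    have TN: "transpose N *v a = Re l *\<^sub>R a - Im l *\<^sub>R b" "transpose N *v b = Re l *\<^sub>R b + Im l *\<^sub>R a"
    proof -
      have "Re_vec (l *s v) = Re l *\<^sub>R a - Im l *\<^sub>R b" "Im_vec (l *s v) = Re l *\<^sub>R b + Im l *\<^sub>R a"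
        by (simp_all add: a_def b_def Re_vec_def Im_vec_def vec_eq_iff)
      then show "transpose N *v a = Re l *\<^sub>R a - Im l *\<^sub>R b" "transpose N *v b = Re l *\<^sub>R b + Im l *\<^sub>R a"
        using arg_cong[OF v(1), of Re_vec] arg_cong[OF v(1), of Im_vec]
        by (simp_all add: Re_vec_mult Im_vec_mult a_def b_def del: transpose_matrix_vector)
    qed
    have closed_loop: "c \<bullet> ((A + B ** K) *v x) = (transpose N *v c + (\<rho> / 2) *\<^sub>R c) \<bullet> x"
      if "transpose B *v c = 0" for c x
    proof -
      have Bc: "c \<bullet> (B *v u) = 0" for u
        using transpose_adjoint[of u B c] that by (simp add: inner_commute del: transpose_matrix_vector)
      \<comment> \<open>The difference between the closed loop with gain \<open>K\<close> and the
        one defining \<open>Abar\<close> factors through \<open>B\<close>, hence is invisible to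
        \<open>c\<close>.\<close>
      define L where "L = matrix_inv S ** (transpose B ** P + transpose D ** P ** C) + K"
      have "A + B ** K = N + (\<rho> / 2) *\<^sub>R mat 1 + B ** L"
        by (simp add: N_def Abar S_def L_def matrix_add_ldistrib matrix_mul_assoc)
      then have "(A + B ** K) *v x = N *v x + (\<rho> / 2) *\<^sub>R x + B *v (L *v x)"
        by (simp add: matrix_vector_mult_add_rdistrib matrix_vector_mul_assoc scaleR_matrix_vector_assoc[symmetric])
      then have "c \<bullet> ((A + B ** K) *v x) = c \<bullet> (N *v x) + (\<rho> / 2) * (c \<bullet> x)"
        by (simp add: inner_add_right Bc)
      also have "c \<bullet> (N *v x) = (transpose N *v c) \<bullet> x"
        using transpose_adjoint[of x N c] by (simp add: inner_commute del: transpose_matrix_vector)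
      finally show ?thesis by (simp add: inner_add_left del: transpose_matrix_vector)
    qed
    \<comment> \<open>The bilinear pairing of \<open>v\<close> with a real vector, without
      conjugation, so that \<open>eig\<close> has eigenvalue \<open>l + \<rho> / 2\<close> and not
      its conjugate.\<close>
    define \<phi> where "\<phi> = (\<lambda>x. Complex (a \<bullet> x) (b \<bullet> x))"
    have lin: "bounded_linear \<phi>"
      unfolding linear_conv_bounded_linear[symmetric]
      by (rule linearI) (simp_all add: \<phi>_def inner_add_right complex_eq_iff)
    have eig: "\<phi> ((A + B ** K) *v x) = (l + complex_of_real (\<rho> / 2)) * \<phi> x" for x
      unfolding \<phi>_def closed_loop[OF B0(1)] closed_loop[OF B0(2)] TN
      by (simp add: complex_eq_iff inner_add_left inner_diff_left algebra_simps)
    have \<phi>0: "\<phi> x0 = 0" for x0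
    proof -
      obtain x where "linear_sde_solution \<Omega> F W (A + B ** K) (C + D ** K) x0 x"
        "(\<integral>\<^sup>+\<omega>. (\<integral>\<^sup>+t\<in>{0..}. ennreal (exp (- \<rho> * t) * (norm (x t \<omega>))\<^sup>2) \<partial>lborel) \<partial>\<Omega>) < \<infinity>"
        using K by blast
      from discounted_solution_left_eigenvector[OF this lin eig] v(2) show ?thesis by simp
    qed
    have "a = 0" using \<phi>0[of a] by (simp add: \<phi>_def complex_eq_iff)
    moreover have "b = 0" using \<phi>0[of b] by (simp add: \<phi>_def complex_eq_iff)
    ultimately show "v = 0" by (intro Re_Im_vec_eq_0) (simp_all add: a_def b_def)
  qed
  have "- transpose N = - transpose Abar + (\<rho> / 2) *\<^sub>R mat 1"
    by (simp add: N_def transpose_def mat_def vec_eq_iff)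
  with no_imag have no_imag': "Re l \<noteq> 0" if "complex_eigenvalue (block_matrix N G (- Q) (- transpose N)) l" for l
    using that by (simp add: N_def)
  have ex: "\<exists>s x. mean_field_solution \<rho> Abar G Q x0 s x" for x0
    by (rule mean_field_solution_exists[OF G_psd sym(1)]) (fact no_imag'[unfolded N_def] stab[unfolded N_def])+
  obtain s xbar where sol: "mean_field_solution \<rho> Abar G Q xbar0 s xbar" using ex by blast
  have "s' t = s t \<and> xbar' t = xbar t"
    if "mean_field_solution \<rho> Abar G Q xbar0 s' xbar'" "t \<ge> 0" for s' xbar' t
    using mean_field_solution_unique[of G Q \<rho> Abar, OF _ sym(1) ex _ that(2)]
      mean_field_solution_diff[OF that(1) sol] G_psd
    by (fastforce simp: pos_semidef_def)
  with sol show ?thesis by blast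
qed

end
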